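(* Let $P_t$ be a discrete polymatroid on $[n]$ with rank function $r_t$, given by a value oracle, and let $\boldsymbol{\ell}_{t-1}\in\mathbb{Z}_{\ge0}^n$ be a load vector. Consider the following greedy procedure (Brick-Laying). Let $\widetilde{r}_t(A)=r_t(A)+\boldsymbol{\ell}_{t-1}(A)$ for $A\subseteq[n]$ and let $\widetilde{P}_t$ be the discrete polymatroid with rank function $\widetilde{r}_t$. Start with $\mathbf{x}^{(0)}=\vec{0}$ and $k=0$. While $\mathbf{x}^{(k)}\notin\mathrm{Bases}(\widetilde{P}_t)$: choose an index $i_k$ minimizing $\mathbf{x}^{(k)}(i)$ among all $i\in[n]$ with $\mathbf{x}^{(k)}+\chi_i\in\widetilde{P}_t$ (ties broken arbitrarily), set $\mathbf{x}^{(k+1)}=\mathbf{x}^{(k)}+\chi_{i_k}$, and increase $k$ by one. When the loop ends, return $\mathbf{x}_t=\mathbf{x}^{(k)}-\boldsymbol{\ell}_{t-1}$. Then, given $P_t$ and $\boldsymbol{\ell}_{t-1}$ as input, this procedure computes, in polynomial time, a basis $\mathbf{x}_t\in\mathrm{Bases}(P_t)$ for which $\mathbf{x}_t+\boldsymbol{\ell}_{t-1}$ is majorization minimal, i.e. $\mathbf{x}_t+\boldsymbol{\ell}_{t-1}\preceq\mathbf{x}+\boldsymbol{\ell}_{t-1}$ for all $\mathbf{x}\in\mathrm{Bases}(P_t)$.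
   Context: $[n]=\{1,\dots,n\}$; for a vector $\mathbf{x}$ indexed by $[n]$ and $A\subseteq[n]$, $\mathbf{x}(A)=\sum_{i\in A}\mathbf{x}(i)$; $\chi_i$ is the $i$-th standard basis vector. A rank function is $r:2^{[n]}\to\mathbb{Z}_{\ge 0}$ that is normalized ($r(\emptyset)=0$), monotone ($r(A)\le r(B)$ for $A\subseteq B$) and submodular ($r(A)+r(B)\ge r(A\cap B)+r(A\cup B)$ for all $A,B$). It defines the discrete polymatroid $P=\{\mathbf{x}\in\mathbb{Z}_{\ge0}^n : \mathbf{x}(A)\le r(A)\ \forall A\subseteq[n]\}$, with $\mathrm{Bases}(P)=\{\mathbf{x}\in P:\mathbf{x}([n])=r([n])\}$. A value oracle for $r$ returns $r(A)$ given any $A\subseteq[n]$. For $\mathbf{x},\mathbf{y}\in\mathbb{Z}_{\ge0}^n$ with $\mathbf{x}([n])=\mathbf{y}([n])$, write $\mathbf{x}\succeq\mathbf{y}$ (equivalently $\mathbf{y}\preceq\mathbf{x}$) when $\mathbf{x}^{\uparrow}([k])\le\mathbf{y}^{\uparrow}([k])$ for all $k\in[n]$, where $\mathbf{x}^\uparrow(i)$ is the $i$-th smallest entry of $\mathbf{x}$.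
   Formalization: "Polynomial time" is taken with numbers counted in unary, i.e. polynomial in n + r_t([n]) + ℓ_{t-1}([n]); with binary numbers the claim fails (n = 1, r_t([1]) = 2^m forces 2^m iterations). *)

theory Defs
  imports
    "HOL-Library.Function_Algebras"
    "HOL-Computational_Algebra.Polynomial"
begin

text \<open>Vectors indexed by \<open>{1..n}\<close> are functions that vanish outside \<open>{1..n}\<close>, with the pointwise
  operations of \<open>Function_Algebras\<close>. The sum \<open>x(A)\<close> of a vector over \<open>A\<close> is \<open>sum x A\<close>.\<close>

definition nonneg_vecs :: "nat \<Rightarrow> (nat \<Rightarrow> int) set" where
  "nonneg_vecs n = {x. (\<forall>i\<in>{1..n}. 0 \<le> x i) \<and> (\<forall>i. i \<notin> {1..n} \<longrightarrow> x i = 0)}"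

definition unit_vec :: "nat \<Rightarrow> nat \<Rightarrow> int" where
  "unit_vec i = (\<lambda>j. if j = i then 1 else 0)"

definition rank_function :: "nat \<Rightarrow> (nat set \<Rightarrow> int) \<Rightarrow> bool" where
  "rank_function n r \<longleftrightarrow>
     (\<forall>A. A \<subseteq> {1..n} \<longrightarrow> 0 \<le> r A) \<and>
     r {} = 0 \<and>
     (\<forall>A B. A \<subseteq> B \<and> B \<subseteq> {1..n} \<longrightarrow> r A \<le> r B) \<and>
     (\<forall>A B. A \<subseteq> {1..n} \<and> B \<subseteq> {1..n} \<longrightarrow> r (A \<inter> B) + r (A \<union> B) \<le> r A + r B)"

definition polymatroid :: "nat \<Rightarrow> (nat set \<Rightarrow> int) \<Rightarrow> (nat \<Rightarrow> int) set" where
  "polymatroid n r = {x \<in> nonneg_vecs n. \<forall>A. A \<subseteq> {1..n} \<longrightarrow> sum x A \<le> r A}"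

definition bases :: "nat \<Rightarrow> (nat set \<Rightarrow> int) \<Rightarrow> (nat \<Rightarrow> int) set" where
  "bases n r = {x \<in> polymatroid n r. sum x {1..n} = r {1..n}}"

text \<open>\<open>sort (map x [1..<Suc n])\<close> lists \<open>x\<^sup>\<up>(1), \<dots>, x\<^sup>\<up>(n)\<close>.\<close>

definition up_sum :: "nat \<Rightarrow> (nat \<Rightarrow> int) \<Rightarrow> nat \<Rightarrow> int" where
  "up_sum n x k = sum_list (take k (sort (map x [1..<Suc n])))"

definition majorized_by :: "nat \<Rightarrow> (nat \<Rightarrow> int) \<Rightarrow> (nat \<Rightarrow> int) \<Rightarrow> bool" where
  "majorized_by n y x \<longleftrightarrow>
     x \<in> nonneg_vecs n \<and> y \<in> nonneg_vecs n \<and> sum x {1..n} = sum y {1..n} \<and>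
     (\<forall>k\<in>{1..n}. up_sum n x k \<le> up_sum n y k)"


section \<open>Brick-Laying\<close>

definition lifted_rank :: "(nat set \<Rightarrow> int) \<Rightarrow> (nat \<Rightarrow> int) \<Rightarrow> nat set \<Rightarrow> int" where
  "lifted_rank r l A = r A + sum l A"

definition lowest_indices :: "nat \<Rightarrow> (nat set \<Rightarrow> int) \<Rightarrow> (nat \<Rightarrow> int) \<Rightarrow> nat set" where
  "lowest_indices n R x =
     {i. is_arg_min x (\<lambda>i. i \<in> {1..n} \<and> x + unit_vec i \<in> polymatroid n R) i}"

text \<open>Arbitrary tie-breaking is modelled by a rule \<open>\<tau>\<close>, over which the results are universally
  quantified: \<open>\<tau> k S\<close> is the index chosen in iteration \<open>k\<close> when \<open>S\<close> is the set of minimizers. As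
  \<open>\<tau>\<close> may depend on \<open>k\<close>, every sequence of choices the procedure can make arises from some
  rule.\<close>

definition tie_rule :: "nat \<Rightarrow> (nat \<Rightarrow> nat set \<Rightarrow> nat) \<Rightarrow> bool" where
  "tie_rule n \<tau> \<longleftrightarrow> (\<forall>k S. S \<subseteq> {1..n} \<and> S \<noteq> {} \<longrightarrow> \<tau> k S \<in> S)"

fun bricks ::
  "nat \<Rightarrow> (nat set \<Rightarrow> int) \<Rightarrow> (nat \<Rightarrow> nat set \<Rightarrow> nat) \<Rightarrow> nat \<Rightarrow> nat \<Rightarrow> int" where
  "bricks n R \<tau> 0 = 0"
| "bricks n R \<tau> (Suc k) =
     bricks n R \<tau> k + unit_vec (\<tau> k (lowest_indices n R (bricks n R \<tau> k)))"

text \<open>The loop stops after \<open>K\<close> iterations, in each of which there was an index to choose, and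
  the procedure returns \<open>x\<close>. At most one \<open>K\<close>, hence at most one \<open>x\<close>, satisfies this.\<close>

definition brick_laying_returns ::
  "nat \<Rightarrow> (nat set \<Rightarrow> int) \<Rightarrow> (nat \<Rightarrow> int) \<Rightarrow> (nat \<Rightarrow> nat set \<Rightarrow> nat) \<Rightarrow> (nat \<Rightarrow> int) \<Rightarrow> bool"
where
  "brick_laying_returns n r l \<tau> x \<longleftrightarrow>
     (let R = lifted_rank r l in
      \<exists>K. (\<forall>k<K. bricks n R \<tau> k \<notin> bases n R \<and> lowest_indices n R (bricks n R \<tau> k) \<noteq> {}) \<and>
          bricks n R \<tau> K \<in> bases n R \<and>
          x = bricks n R \<tau> K - l)"


section \<open>Programs with a value oracle\<close>

text \<open>Running time is measured on while-programs over finitely many named integer arrays; a scalar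
  is cell 0 of an array. Every assignment, test and oracle call costs one unit. As addition and
  subtraction are the only arithmetic operations, the bit length of the numbers grows by at most a
  program-dependent constant per step, so that up to a polynomial the cost is that of a Turing
  machine with the same oracles.

  The program accesses the rank function only by \<open>Rank v a\<close>, which writes to \<open>v\<close> the rank of the
  set whose characteristic vector (nonzero meaning membership) is stored in \<open>a\<close>. Likewise,
  \<open>Tie v k a\<close> asks the tie-breaking rule for its choice in iteration \<open>k\<close> from the set stored in
  \<open>a\<close>.\<close>

type_synonym vname = string
type_synonym state = "vname \<Rightarrow> int \<Rightarrow> int"

datatype aexp = Num int | Cell vname aexp | Plus aexp aexp | Minus aexp aexp

datatype bexp = Less aexp aexp | Neg bexp | Conj bexp bexp

datatype com =
    Skip
  | Assign vname aexp aexp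
  | Rank vname vname
  | Tie vname vname vname
  | Seq com com
  | Cond bexp com com
  | While bexp com

fun aval :: "aexp \<Rightarrow> state \<Rightarrow> int" where
  "aval (Num c) s = c"
| "aval (Cell v e) s = s v (aval e s)"
| "aval (Plus e f) s = aval e s + aval f s"
| "aval (Minus e f) s = aval e s - aval f s"

fun bval :: "bexp \<Rightarrow> state \<Rightarrow> bool" where
  "bval (Less e f) s \<longleftrightarrow> aval e s < aval f s"
| "bval (Neg b) s \<longleftrightarrow> \<not> bval b s"
| "bval (Conj b c) s \<longleftrightarrow> bval b s \<and> bval c s"

definition store :: "state \<Rightarrow> vname \<Rightarrow> int \<Rightarrow> int \<Rightarrow> state" where
  "store s v i z = s(v := (s v)(i := z))"

definition stored_set :: "nat \<Rightarrow> state \<Rightarrow> vname \<Rightarrow> nat set" where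
  "stored_set n s a = {i \<in> {1..n}. s a (int i) \<noteq> 0}"

text \<open>\<open>exec n r \<tau> c s t s'\<close>: started in state \<open>s\<close>, program \<open>c\<close> halts in state \<open>s'\<close> after \<open>t\<close> time
  units. In \<open>Assign v e f\<close>, \<open>e\<close> is the position in array \<open>v\<close> and \<open>f\<close> the new content.\<close>

inductive exec ::
  "nat \<Rightarrow> (nat set \<Rightarrow> int) \<Rightarrow> (nat \<Rightarrow> nat set \<Rightarrow> nat) \<Rightarrow> com \<Rightarrow> state \<Rightarrow> nat \<Rightarrow> state \<Rightarrow> bool"
  for n r \<tau>
where
  Skip: "exec n r \<tau> Skip s 1 s"
| Assign: "exec n r \<tau> (Assign v e f) s 1 (store s v (aval e s) (aval f s))"
| Rank: "exec n r \<tau> (Rank v a) s 1 (store s v 0 (r (stored_set n s a)))"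
| Tie: "exec n r \<tau> (Tie v k a) s 1 (store s v 0 (int (\<tau> (nat (s k 0)) (stored_set n s a))))"
| Seq: "exec n r \<tau> c1 s t1 s1 \<Longrightarrow> exec n r \<tau> c2 s1 t2 s2 \<Longrightarrow>
    exec n r \<tau> (Seq c1 c2) s (t1 + t2) s2"
| CondTrue: "bval b s \<Longrightarrow> exec n r \<tau> c1 s t s1 \<Longrightarrow> exec n r \<tau> (Cond b c1 c2) s (1 + t) s1"
| CondFalse: "\<not> bval b s \<Longrightarrow> exec n r \<tau> c2 s t s1 \<Longrightarrow> exec n r \<tau> (Cond b c1 c2) s (1 + t) s1"
| WhileFalse: "\<not> bval b s \<Longrightarrow> exec n r \<tau> (While b c) s 1 s"
| WhileTrue: "bval b s \<Longrightarrow> exec n r \<tau> c s t1 s1 \<Longrightarrow> exec n r \<tau> (While b c) s1 t2 s2 \<Longrightarrow>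
    exec n r \<tau> (While b c) s (1 + t1 + t2) s2"

definition input_state :: "nat \<Rightarrow> (nat \<Rightarrow> int) \<Rightarrow> state" where
  "input_state n l = (\<lambda>v i.
     if v = ''n'' \<and> i = 0 then int n
     else if v = ''l'' \<and> 1 \<le> i \<and> i \<le> int n then l (nat i)
     else 0)"

definition output_vec :: "nat \<Rightarrow> state \<Rightarrow> nat \<Rightarrow> int" where
  "output_vec n s = (\<lambda>i. if i \<in> {1..n} then s ''x'' (int i) else 0)"

text \<open>The input size, with the numbers in unary. In binary no polynomial bound is possible: the
  loop of the procedure takes \<open>r {1..n} + sum l {1..n}\<close> iterations.\<close>

definition input_size :: "nat \<Rightarrow> (nat set \<Rightarrow> int) \<Rightarrow> (nat \<Rightarrow> int) \<Rightarrow> nat" where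
  "input_size n r l = n + nat (r {1..n}) + nat (sum l {1..n})"

end

theory Submission
  imports Defs "HOL-Library.Multiset"
begin

text \<open>Correctness. Throughout the procedure every index \<open>i\<close> either lies in a tight set on which no
  entry exceeds \<open>y i + 1\<close>, or no entry at all exceeds \<open>y i + 1\<close>. For the final base, the union of
  the tight sets of the indices below level \<open>h\<close> is tight and contains only entries at most \<open>h\<close>,
  hence the final base minimizes \<open>\<Sum>i. max 0 (h - y i)\<close> over all bases for every \<open>h\<close>, which is
  majorization minimality.

  Running time. Whether a brick may be placed on \<open>i\<close> amounts to whether an integer-valued
  submodular function \<open>f\<close>, with marginal values bounded by some \<open>C\<close>, is non-negative. Add up
  greedy vertices of the base polytope of \<open>f\<close>, each computed in increasing order of the current
  sum \<open>z\<close>. If \<open>f A < 0\<close>, then \<open>z(A) \<le> - k\<close> after \<open>k\<close> rounds. If \<open>f \<ge> 0\<close>, each added vertex has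
  non-negative inner product with the negative part of \<open>z\<close>, whose squared norm therefore grows by
  at most \<open>n * C\<^sup>2\<close> per round. So \<open>n\<^sup>2 * C\<^sup>2 + 1\<close> rounds tell the two cases apart, which is
  polynomial since the numbers are measured in unary.\<close>

section \<open>Majorization through truncated sums\<close>

text \<open>Each summand is at least \<open>0\<close> and at least \<open>h - x\<close>; the second
  bound is used on the \<open>k\<close> smallest entries, the first on the rest. Together with the
  equality for a suitable \<open>h\<close>, this makes the sum of the \<open>k\<close> smallest
  entries a maximum over \<open>h\<close>.\<close>

lemma sum_list_take_sort_ge:
  fixes xs :: "int list" and h :: int
  assumes "k \<le> length xs"
  shows "int k * h - (\<Sum>x\<leftarrow>xs. max 0 (h - x)) \<le> sum_list (take k (sort xs))"
proof -
  let ?ys = "sort xs" and ?g = "\<lambda>x. max 0 (h - x)"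
  have "mset (map ?g ?ys) = mset (map ?g xs)" by simp
  then have "sum_list (map ?g xs) = sum_list (map ?g ?ys)"
    by (metis sum_mset_sum_list)
  also have "\<dots> = sum_list (map ?g (take k ?ys)) + sum_list (map ?g (drop k ?ys))"
    by (metis append_take_drop_id map_append sum_list_append)
  finally have *: "sum_list (map ?g xs)
      = sum_list (map ?g (take k ?ys)) + sum_list (map ?g (drop k ?ys))" .
  have "0 \<le> sum_list (map ?g (drop k ?ys))"
    by (rule sum_list_nonneg) auto
  moreover have "int (length zs) * h - sum_list zs \<le> sum_list (map ?g zs)" for zs
    by (induction zs) (auto simp: algebra_simps)
  from this[of "take k ?ys"] have "int k * h - sum_list (take k ?ys) \<le> sum_list (map ?g (take k ?ys))"
    using assms by (simp add: min_absorb2)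
  ultimately show ?thesis using * by linarith
qed

text \<open>With \<open>h\<close> the \<open>k\<close>-th smallest entry, no summand among the first
  \<open>k\<close> sorted entries is truncated and all later summands vanish. The index is
  \<open>k - 1\<close> because lists count from zero.\<close>

lemma sum_list_take_sort_eq:
  fixes xs :: "int list"
  assumes "0 < k" "k \<le> length xs"
  defines "h \<equiv> sort xs ! (k - 1)"
  shows "sum_list (take k (sort xs)) = int k * h - (\<Sum>x\<leftarrow>xs. max 0 (h - x))"
proof -
  let ?ys = "sort xs" and ?g = "\<lambda>x. max 0 (h - x)"
  have "mset (map ?g ?ys) = mset (map ?g xs)" by simp
  then have "sum_list (map ?g xs) = sum_list (map ?g ?ys)"
    by (metis sum_mset_sum_list)
  also have "\<dots> = sum_list (map ?g (take k ?ys)) + sum_list (map ?g (drop k ?ys))"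
    by (metis append_take_drop_id map_append sum_list_append)
  finally have *: "sum_list (map ?g xs)
      = sum_list (map ?g (take k ?ys)) + sum_list (map ?g (drop k ?ys))" .
  have "h \<le> x" if "x \<in> set (drop k ?ys)" for x
  proof -
    from that obtain i where "i < length (drop k ?ys)" "x = drop k ?ys ! i"
      by (metis in_set_conv_nth)
    then show ?thesis
      unfolding h_def by (auto intro!: sorted_nth_mono)
  qed
  then have "sum_list (map ?g (drop k ?ys)) = 0"
    by (induction ("drop k ?ys")) auto
  moreover have "int (length zs) * h - sum_list zs = sum_list (map ?g zs)" if "\<forall>x\<in>set zs. x \<le> h" for zs
    using that by (induction zs) (auto simp: algebra_simps)
  moreover have "\<forall>x\<in>set (take k ?ys). x \<le> h"
  proof
    fix x assume "x \<in> set (take k ?ys)"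
    then obtain i where "i < k" "x = ?ys ! i" using assms(2) by (auto simp: in_set_conv_nth)
    then show "x \<le> h" using assms(1,2) unfolding h_def by (simp add: sorted_nth_mono)
  qed
  moreover have "length (take k ?ys) = k" using assms by simp
  ultimately show ?thesis using * by fastforce
qed

lemma up_sum_mono_truncation:
  assumes "\<And>h. (\<Sum>i\<in>{1..n}. max 0 (h - y i)) \<le> (\<Sum>i\<in>{1..n}. max 0 (h - x i))"
    and "k \<in> {1..n}"
  shows "up_sum n x k \<le> up_sum n y k"
proof -
  have conv: "(\<Sum>z\<leftarrow>map w [1..<Suc n]. max 0 (h - z)) = (\<Sum>i\<in>{1..n}. max 0 (h - w i))" for w h
    using sum_set_upt_conv_sum_list_nat[of "\<lambda>i. max 0 (h - w i)" 1 "Suc n"]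
    by (simp add: o_def atLeastLessThanSuc_atLeastAtMost del: upt_Suc)
  \<comment> \<open>This \<open>h\<close> is optimal for \<open>x\<close>; for \<open>y\<close> it
    only gives a lower bound, which is the direction needed.\<close>
  define h where "h = sort (map x [1..<Suc n]) ! (k - 1)"
  have "up_sum n x k = int k * h - (\<Sum>i\<in>{1..n}. max 0 (h - x i))"
    using sum_list_take_sort_eq[of k "map x [1..<Suc n]"] assms(2)
    unfolding up_sum_def h_def conv by simp
  also have "\<dots> \<le> int k * h - (\<Sum>i\<in>{1..n}. max 0 (h - y i))"
    using assms(1)[of h] by simp
  also have "\<dots> \<le> up_sum n y k"
    using sum_list_take_sort_ge[of k "map y [1..<Suc n]" h] assms(2)
    unfolding up_sum_def conv by simp
  finally show ?thesis .
qed

section \<open>Tight sets and Brick-Laying\<close>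

lemma rank_functionD:
  assumes "rank_function n r"
  shows "r {} = 0"
    and "A \<subseteq> {1..n} \<Longrightarrow> 0 \<le> r A"
    and "A \<subseteq> B \<Longrightarrow> B \<subseteq> {1..n} \<Longrightarrow> r A \<le> r B"
    and "A \<subseteq> {1..n} \<Longrightarrow> B \<subseteq> {1..n} \<Longrightarrow> r (A \<inter> B) + r (A \<union> B) \<le> r A + r B"
  using assms unfolding rank_function_def by simp_all

lemma sum_unit_vec:
  assumes "finite A"
  shows "sum (unit_vec i) A = of_bool (i \<in> A)"
  using assms by (simp add: unit_vec_def sum.delta of_bool_def)

lemma rank_function_lifted_rank:
  assumes r: "rank_function n r" and l: "l \<in> nonneg_vecs n"
  shows "rank_function n (lifted_rank r l)"
  unfolding rank_function_def lifted_rank_def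
proof (intro conjI allI impI)
  have nn: "0 \<le> l i" for i
    using l by (cases "i \<in> {1..n}") (auto simp: nonneg_vecs_def)
  fix A B
  show "0 \<le> r A + sum l A" if "A \<subseteq> {1..n}"
    using rank_functionD(2)[OF r that] by (simp add: nn sum_nonneg)
  show "r {} + sum l {} = 0" using rank_functionD(1)[OF r] by simp
  show "r A + sum l A \<le> r B + sum l B" if "A \<subseteq> B \<and> B \<subseteq> {1..n}"
  proof -
    have "finite B" using that finite_subset by blast
    then have "sum l A \<le> sum l B" using that nn by (intro sum_mono2) auto
    then show ?thesis using rank_functionD(3)[OF r, of A B] that by simp
  qed
  show "r (A \<inter> B) + sum l (A \<inter> B) + (r (A \<union> B) + sum l (A \<union> B))
      \<le> r A + sum l A + (r B + sum l B)" if *: "A \<subseteq> {1..n} \<and> B \<subseteq> {1..n}"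
  proof -
    have "finite A" "finite B" using * finite_subset by blast+
    then have "sum l (A \<union> B) + sum l (A \<inter> B) = sum l A + sum l B" by (rule sum.union_inter)
    then show ?thesis using rank_functionD(4)[OF r, of A B] * by simp
  qed
qed

section \<open>Tight sets and admissible bricks\<close>

definition tight :: "nat \<Rightarrow> (nat set \<Rightarrow> int) \<Rightarrow> (nat \<Rightarrow> int) \<Rightarrow> nat set \<Rightarrow> bool" where
  "tight n R y A \<longleftrightarrow> A \<subseteq> {1..n} \<and> sum y A = R A"

text \<open>Uncrossing: the slack \<open>R A - sum y A\<close> is non-negative and submodular, so
  its zeros are closed under union.\<close>

lemma tight_Un:
  assumes R: "rank_function n R" and y: "y \<in> polymatroid n R"
    and A: "tight n R y A" and B: "tight n R y B"
  shows "tight n R y (A \<union> B)"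
proof -
  have sub: "A \<subseteq> {1..n}" "B \<subseteq> {1..n}" using A B by (auto simp: tight_def)
  then have "finite A" "finite B" using finite_subset by blast+
  then have "sum y (A \<union> B) + sum y (A \<inter> B) = sum y A + sum y B" by (rule sum.union_inter)
  moreover have "A \<union> B \<subseteq> {1..n}" "A \<inter> B \<subseteq> {1..n}" using sub by auto
  then have "sum y (A \<union> B) \<le> R (A \<union> B)" "sum y (A \<inter> B) \<le> R (A \<inter> B)"
    using y by (simp_all add: polymatroid_def)
  moreover note rank_functionD(4)[OF R sub]
  ultimately show ?thesis using A B by (auto simp: tight_def)
qed

lemma tight_UN:
  assumes R: "rank_function n R" and y: "y \<in> polymatroid n R"
    and "finite I" "\<And>i. i \<in> I \<Longrightarrow> tight n R y (A i)"
  shows "tight n R y (\<Union>i\<in>I. A i)"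
  using assms(3,4)
proof (induction I rule: finite_induct)
  case empty
  then show ?case using rank_functionD(1)[OF R] by (simp add: tight_def)
next
  case (insert i I)
  then show ?case using tight_Un[OF R y, of "A i"] by simp
qed

text \<open>By integrality: a brick on \<open>i\<close> raises \<open>sum y A\<close> by one exactly
  for the sets containing \<open>i\<close>, so it violates precisely those whose slack was
  zero.\<close>

lemma add_unit_vec_polymatroid_iff:
  assumes y: "y \<in> polymatroid n R" and i: "i \<in> {1..n}"
  shows "y + unit_vec i \<in> polymatroid n R \<longleftrightarrow> \<not> (\<exists>A. tight n R y A \<and> i \<in> A)"
proof -
  have "y + unit_vec i \<in> nonneg_vecs n"
    using y i by (auto simp: polymatroid_def nonneg_vecs_def unit_vec_def)
  then have "y + unit_vec i \<in> polymatroid n R \<longleftrightarrow>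
      (\<forall>A. A \<subseteq> {1..n} \<longrightarrow> sum (y + unit_vec i) A \<le> R A)"
    by (simp add: polymatroid_def)
  moreover have "sum (y + unit_vec i) A \<le> R A \<longleftrightarrow> \<not> (sum y A = R A \<and> i \<in> A)"
    if A: "A \<subseteq> {1..n}" for A
  proof -
    have "sum (y + unit_vec i) A = sum y A + of_bool (i \<in> A)"
      using finite_subset[OF A] by (simp add: sum.distrib sum_unit_vec)
    moreover have "sum y A \<le> R A" using y A by (simp add: polymatroid_def)
    ultimately show ?thesis by auto
  qed
  ultimately show ?thesis unfolding tight_def by blast
qed

lemma lowest_indices_iff:
  "i \<in> lowest_indices n R y \<longleftrightarrow> i \<in> {1..n} \<and> y + unit_vec i \<in> polymatroid n R \<and>
     (\<forall>j\<in>{1..n}. y + unit_vec j \<in> polymatroid n R \<longrightarrow> y i \<le> y j)"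
  by (auto simp: lowest_indices_def is_arg_min_def not_less)

text \<open>If every index were blocked, the blocking tight sets would cover \<open>{1..n}\<close>,
  and their union would be tight, contradicting the strict inequality.\<close>

lemma lowest_indices_nonempty:
  assumes R: "rank_function n R" and y: "y \<in> polymatroid n R" and less: "sum y {1..n} < R {1..n}"
  shows "lowest_indices n R y \<noteq> {}"
proof -
  define F where "F = {i \<in> {1..n}. y + unit_vec i \<in> polymatroid n R}"
  have "F \<noteq> {}"
  proof
    assume "F = {}"
    then have "\<exists>A. tight n R y A \<and> i \<in> A" if "i \<in> {1..n}" for i
      using add_unit_vec_polymatroid_iff[OF y that] that unfolding F_def by blast
    then obtain A where A: "\<And>i. i \<in> {1..n} \<Longrightarrow> tight n R y (A i) \<and> i \<in> A i" by metis
    then have "tight n R y (\<Union>i\<in>{1..n}. A i)" by (intro tight_UN[OF R y]) auto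
    moreover have "(\<Union>i\<in>{1..n}. A i) = {1..n}" using A unfolding tight_def by blast
    ultimately show False using less by (simp add: tight_def)
  qed
  moreover have "finite F" by (simp add: F_def)
  ultimately obtain i where "is_arg_min y (\<lambda>i. i \<in> F) i" using ex_is_arg_min_if_finite by blast
  then have "i \<in> lowest_indices n R y" by (simp add: F_def lowest_indices_def)
  then show ?thesis by blast
qed

text \<open>The invariant that makes Brick-Laying majorization minimal: an entry can exceed
  \<open>y i\<close> by two only outside some tight set that blocks \<open>i\<close> for good.\<close>

definition levelled :: "nat \<Rightarrow> (nat set \<Rightarrow> int) \<Rightarrow> (nat \<Rightarrow> int) \<Rightarrow> bool" where
  "levelled n R y \<longleftrightarrow> (\<forall>i\<in>{1..n}.
     (\<exists>A. tight n R y A \<and> i \<in> A \<and> (\<forall>j\<in>A. y j \<le> y i + 1)) \<or> (\<forall>j\<in>{1..n}. y j \<le> y i + 1))"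

lemma levelled_add_lowest:
  assumes y: "y \<in> polymatroid n R" and lev: "levelled n R y" and p: "p \<in> lowest_indices n R y"
  shows "levelled n R (y + unit_vec p)"
  unfolding levelled_def
proof
  let ?y = "y + unit_vec p"
  have p': "p \<in> {1..n}" "y + unit_vec p \<in> polymatroid n R" using p by (auto simp: lowest_indices_iff)
  fix i assume i: "i \<in> {1..n}"
  have keep: "\<exists>A. tight n R ?y A \<and> i \<in> A \<and> (\<forall>j\<in>A. ?y j \<le> ?y i + 1)"
    if A: "tight n R y A" "i \<in> A" "\<forall>j\<in>A. y j \<le> y i + 1" for A
  proof -
    \<comment> \<open>A brick fits on \<open>p\<close>, so \<open>p\<close> lies in no tight set;
      hence neither the entries on \<open>A\<close> nor its tightness change.\<close>
    have "p \<notin> A" using add_unit_vec_polymatroid_iff[OF y p'(1)] p'(2) A(1) by blast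
    moreover from this have "sum ?y A = sum y A"
      by (intro sum.cong) (auto simp: unit_vec_def)
    ultimately show ?thesis using A
      by (intro exI[of _ A]) (auto simp: tight_def unit_vec_def)
  qed
  consider A where "tight n R y A" "i \<in> A" "\<forall>j\<in>A. y j \<le> y i + 1"
    | "\<forall>j\<in>{1..n}. y j \<le> y i + 1" using lev i unfolding levelled_def by blast
  then show "(\<exists>A. tight n R ?y A \<and> i \<in> A \<and> (\<forall>j\<in>A. ?y j \<le> ?y i + 1))
      \<or> (\<forall>j\<in>{1..n}. ?y j \<le> ?y i + 1)"
  proof cases
    case 1
    then show ?thesis using keep by blast
  next
    case 2
    show ?thesis
    proof (cases "y p \<le> y i")
      case True
      then show ?thesis using 2 by (auto simp: unit_vec_def)
    next
      case False
      \<comment> \<open>Here \<open>i\<close> is lower than \<open>p\<close>, so by minimality of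
        \<open>p\<close> it must be blocked; its blocking set inherits the bound that held for all
        entries.\<close>
      then have "y + unit_vec i \<notin> polymatroid n R" using p i by (auto simp: lowest_indices_iff)
      then obtain A where A: "tight n R y A" "i \<in> A"
        using add_unit_vec_polymatroid_iff[OF y i] by blast
      then have "\<forall>j\<in>A. y j \<le> y i + 1" using 2 unfolding tight_def by blast
      then show ?thesis by (intro disjI1 keep[OF A])
    qed
  qed
qed

lemma levelled_base_truncation_le:
  assumes R: "rank_function n R" and y: "y \<in> bases n R" and lev: "levelled n R y"
    and x: "x \<in> bases n R"
  shows "(\<Sum>i\<in>{1..n}. max 0 (h - y i)) \<le> (\<Sum>i\<in>{1..n}. max 0 (h - x i))"
proof -
  have yP: "y \<in> polymatroid n R" and "tight n R y {1..n}"
    using y by (auto simp: bases_def tight_def)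
  \<comment> \<open>For a base the whole ground set is tight, so the second alternative of
    \<open>levelled\<close> becomes an instance of the first.\<close>
  then have "\<forall>i\<in>{1..n}. \<exists>A. tight n R y A \<and> i \<in> A \<and> (\<forall>j\<in>A. y j \<le> y i + 1)"
    using lev by (auto simp: levelled_def)
  then obtain A where A: "\<And>i. i \<in> {1..n} \<Longrightarrow>
      tight n R y (A i) \<and> i \<in> A i \<and> (\<forall>j\<in>A i. y j \<le> y i + 1)"
    by metis
  define B where "B = (\<Union>i\<in>{i\<in>{1..n}. y i < h}. A i)"
  have "tight n R y B" unfolding B_def using A by (intro tight_UN[OF R yP]) auto
  then have B: "B \<subseteq> {1..n}" "sum y B = R B" by (auto simp: tight_def)
  \<comment> \<open>The tolerance of one in \<open>levelled\<close> is absorbed here: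
    \<open>y i < h\<close> means \<open>y i + 1 \<le> h\<close>.\<close>
  have le: "y j \<le> h" if "j \<in> B" for j using that A by (fastforce simp: B_def)
  have ge: "h \<le> y j" if "j \<in> {1..n}" "j \<notin> B" for j
    using that A[of j] by (auto simp: B_def not_less)
  have "(\<Sum>i\<in>{1..n}. max 0 (h - y i)) = (\<Sum>i\<in>B. max 0 (h - y i))"
    using B ge by (intro sum.mono_neutral_right) auto
  also have "\<dots> = (\<Sum>i\<in>B. h - y i)" using le by (intro sum.cong) auto
  also have "\<dots> = (\<Sum>i\<in>B. h) - R B" using B by (simp add: sum_subtractf)
  \<comment> \<open>On \<open>B\<close> the base \<open>x\<close> obeys the rank bound that
    \<open>y\<close> attains, so passing to \<open>x\<close> can only enlarge the deficit.\<close>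
  also have "\<dots> \<le> (\<Sum>i\<in>B. h) - sum x B" using x B by (simp add: bases_def polymatroid_def)
  also have "\<dots> = (\<Sum>i\<in>B. h - x i)" by (simp add: sum_subtractf)
  also have "\<dots> \<le> (\<Sum>i\<in>B. max 0 (h - x i))" by (intro sum_mono) auto
  also have "\<dots> \<le> (\<Sum>i\<in>{1..n}. max 0 (h - x i))" using B by (intro sum_mono2) auto
  finally show ?thesis .
qed

section \<open>Correctness of the procedure\<close>

lemma tie_rule_lowest:
  assumes "tie_rule n \<tau>" "lowest_indices n R y \<noteq> {}"
  shows "\<tau> k (lowest_indices n R y) \<in> lowest_indices n R y"
proof -
  have "lowest_indices n R y \<subseteq> {1..n}" by (auto simp: lowest_indices_iff)
  then show ?thesis using assms unfolding tie_rule_def by blast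
qed

text \<open>Each brick adds one to the total, so before \<open>R {1..n}\<close> bricks are laid the
  vector is not yet a base and some index is free. The zero vector is levelled because its entries
  are all equal.\<close>

lemma bricks_invariant:
  assumes R: "rank_function n R" and \<tau>: "tie_rule n \<tau>" and "k \<le> nat (R {1..n})"
  shows "bricks n R \<tau> k \<in> polymatroid n R \<and> sum (bricks n R \<tau> k) {1..n} = int k
    \<and> levelled n R (bricks n R \<tau> k)"
  using assms(3)
proof (induction k)
  case 0
  then show ?case using rank_functionD[OF R]
    by (auto simp: polymatroid_def nonneg_vecs_def levelled_def)
next
  case (Suc k)
  let ?y = "bricks n R \<tau> k"
  define p where "p = \<tau> k (lowest_indices n R ?y)"
  have IH: "?y \<in> polymatroid n R" "sum ?y {1..n} = int k" "levelled n R ?y" using Suc by auto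
  then have "lowest_indices n R ?y \<noteq> {}"
    using lowest_indices_nonempty[OF R] Suc.prems by simp
  then have p: "p \<in> lowest_indices n R ?y" unfolding p_def using tie_rule_lowest[OF \<tau>] by blast
  then have "p \<in> {1..n}" "?y + unit_vec p \<in> polymatroid n R" by (auto simp: lowest_indices_iff)
  moreover have "sum (?y + unit_vec p) {1..n} = int (Suc k)"
    using IH(2) \<open>p \<in> {1..n}\<close> by (simp add: sum.distrib sum_unit_vec)
  ultimately show ?case using levelled_add_lowest[OF IH(1,3) p]
    unfolding bricks.simps(2) p_def by blast
qed

text \<open>The point is \<open>l i \<le> y i\<close>: comparing the total with the bound on
  \<open>{1..n} - {i}\<close> leaves at least \<open>l i + r {1..n} - r ({1..n} - {i})\<close> for
  entry \<open>i\<close>, and \<open>r\<close> is monotone.\<close>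

lemma base_diff_base:
  assumes r: "rank_function n r" and l: "l \<in> nonneg_vecs n"
    and y: "y \<in> bases n (lifted_rank r l)"
  shows "y - l \<in> bases n r"
proof -
  have le: "sum y A \<le> r A + sum l A" if "A \<subseteq> {1..n}" for A
    using y that by (simp add: bases_def polymatroid_def lifted_rank_def)
  have eq: "sum y {1..n} = r {1..n} + sum l {1..n}"
    using y by (simp add: bases_def lifted_rank_def)
  have "l i \<le> y i" if i: "i \<in> {1..n}" for i
  proof -
    have "sum y {1..n} = y i + sum y ({1..n} - {i})" "sum l {1..n} = l i + sum l ({1..n} - {i})"
      using i by (simp_all only: sum.remove[of "{1..n}" i] finite_atLeastAtMost)
    moreover have "r ({1..n} - {i}) \<le> r {1..n}" by (rule rank_functionD(3)[OF r]) auto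
    ultimately show ?thesis using eq le[of "{1..n} - {i}"] by auto
  qed
  moreover have "y i = 0 \<and> l i = 0" if "i \<notin> {1..n}" for i
    using that y l by (simp add: bases_def polymatroid_def nonneg_vecs_def)
  ultimately have "y - l \<in> nonneg_vecs n" by (auto simp: nonneg_vecs_def)
  then show ?thesis
    using le eq by (simp add: bases_def polymatroid_def sum_subtractf diff_le_eq)
qed

lemma base_plus_base:
  assumes l: "l \<in> nonneg_vecs n" and x: "x \<in> bases n r"
  shows "x + l \<in> bases n (lifted_rank r l)"
  using assms by (simp add: bases_def polymatroid_def nonneg_vecs_def lifted_rank_def sum.distrib)

lemma brick_laying_correct:
  assumes r: "rank_function n r" and l: "l \<in> nonneg_vecs n" and \<tau>: "tie_rule n \<tau>"
  defines "R \<equiv> lifted_rank r l"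
  defines "x \<equiv> bricks n R \<tau> (nat (R {1..n})) - l"
  shows "brick_laying_returns n r l \<tau> x" "x \<in> bases n r"
    "y \<in> bases n r \<Longrightarrow> majorized_by n (x + l) (y + l)"
proof -
  have R: "rank_function n R" unfolding R_def by (rule rank_function_lifted_rank[OF r l])
  let ?K = "nat (R {1..n})"
  have K: "int ?K = R {1..n}" using rank_functionD(2)[OF R] by simp
  note inv = bricks_invariant[OF R \<tau>]
  have base: "bricks n R \<tau> ?K \<in> bases n R" using inv[of ?K] K by (simp add: bases_def)
  \<comment> \<open>All earlier totals are below \<open>R {1..n}\<close>, so the loop cannot stop
    before \<open>?K\<close> iterations.\<close>
  have "bricks n R \<tau> k \<notin> bases n R \<and> lowest_indices n R (bricks n R \<tau> k) \<noteq> {}" if "k < ?K" for k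
    using inv[of k] that lowest_indices_nonempty[OF R, of "bricks n R \<tau> k"] K
    by (auto simp: bases_def)
  then show "brick_laying_returns n r l \<tau> x"
    using base unfolding brick_laying_returns_def Let_def R_def x_def by blast
  show "x \<in> bases n r"
    using base_diff_base[OF r l] base by (simp add: x_def R_def)
  assume "y \<in> bases n r"
  then have y: "y + l \<in> bases n R" using base_plus_base[OF l] by (simp add: R_def)
  have "up_sum n (y + l) k \<le> up_sum n (bricks n R \<tau> ?K) k" if "k \<in> {1..n}" for k
    by (intro up_sum_mono_truncation levelled_base_truncation_le[OF R base _ y] that) (simp add: inv)
  then show "majorized_by n (x + l) (y + l)"
    using base y by (simp add: majorized_by_def x_def bases_def polymatroid_def)
qed

section \<open>Testing non-negativity of a submodular function\<close>

text \<open>In contrast to a rank function, \<open>f\<close> may take negative values and need not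
  be monotone, as happens for the slack of a vector outside the polymatroid.\<close>

definition submodular :: "nat \<Rightarrow> (nat set \<Rightarrow> int) \<Rightarrow> bool" where
  "submodular n f \<longleftrightarrow> f {} = 0 \<and>
     (\<forall>A B. A \<subseteq> {1..n} \<and> B \<subseteq> {1..n} \<longrightarrow> f (A \<inter> B) + f (A \<union> B) \<le> f A + f B)"

lemma submodularD:
  assumes "submodular n f"
  shows "f {} = 0"
    and "A \<subseteq> {1..n} \<Longrightarrow> B \<subseteq> {1..n} \<Longrightarrow> f (A \<inter> B) + f (A \<union> B) \<le> f A + f B"
  using assms unfolding submodular_def by simp_all

section \<open>Greedy vertices of the base polytope\<close>

text \<open>A partial run of Edmonds' greedy algorithm: \<open>S\<close> is the prefix processed so
  far, in nondecreasing order of \<open>z\<close>, and \<open>v\<close> holds the marginal values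
  along it. A relation is used so that ties in \<open>z\<close> may be broken in any way.\<close>

inductive greedy :: "nat \<Rightarrow> (nat set \<Rightarrow> int) \<Rightarrow> (nat \<Rightarrow> int) \<Rightarrow> nat set \<Rightarrow> (nat \<Rightarrow> int) \<Rightarrow> bool"
  for n f z where
  empty: "greedy n f z {} (\<lambda>_. 0)"
| insert: "greedy n f z S v \<Longrightarrow> p \<in> {1..n} - S \<Longrightarrow> (\<And>i. i \<in> {1..n} - S \<Longrightarrow> z p \<le> z i) \<Longrightarrow>
    greedy n f z (insert p S) (v(p := f (insert p S) - f S))"

lemma greedy_subset: "greedy n f z S v \<Longrightarrow> S \<subseteq> {1..n}"
  by (induction rule: greedy.induct) auto

lemma greedy_finite: "greedy n f z S v \<Longrightarrow> finite S"
  by (induction rule: greedy.induct) auto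

lemma greedy_outside: "greedy n f z S v \<Longrightarrow> i \<notin> S \<Longrightarrow> v i = 0"
  by (induction rule: greedy.induct) auto

lemma greedy_sum_eq:
  assumes "submodular n f" "greedy n f z S v"
  shows "sum v S = f S"
  using assms(2)
proof (induction rule: greedy.induct)
  case empty
  then show ?case using assms(1) by (simp add: submodular_def)
next
  case (insert S v p)
  have "sum (v(p := c)) S = sum v S" for c using insert.hyps(2) by (intro sum.cong) auto
  then show ?case using insert.hyps(2) insert.IH greedy_finite[OF insert.hyps(1)] by simp
qed

text \<open>Diminishing returns: submodularity for \<open>A\<close> and \<open>S\<close> shows that
  the last element \<open>p\<close> adds no more to \<open>S\<close> than to \<open>A - {p}\<close>.
  With \<open>greedy_sum_eq\<close> this places the full greedy vector in the base polytope of
  \<open>f\<close>.\<close>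

lemma greedy_sum_le:
  assumes f: "submodular n f" and "greedy n f z S v" "A \<subseteq> S"
  shows "sum v A \<le> f A"
  using assms(2,3)
proof (induction arbitrary: A rule: greedy.induct)
  case empty
  then show ?case using assms(1) by (simp add: submodular_def)
next
  case (insert S v p)
  let ?v = "v(p := f (insert p S) - f S)"
  have S: "S \<subseteq> {1..n}" "finite S"
    using greedy_subset[OF insert.hyps(1)] greedy_finite[OF insert.hyps(1)] by auto
  have p: "p \<in> {1..n}" "p \<notin> S" using insert.hyps(2) by auto
  have IH: "sum ?v B \<le> f B" if "B \<subseteq> S" for B
  proof -
    have "sum ?v B = sum v B" using that p(2) by (intro sum.cong) auto
    then show ?thesis using insert.IH[OF that] by simp
  qed
  show ?case
  proof (cases "p \<in> A")
    case False
    then show ?thesis using insert.prems by (intro IH) auto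
  next
    case True
    have "A - {p} \<subseteq> S" using insert.prems by blast
    have fin: "finite A" using finite_subset[OF insert.prems] S(2) by simp
    have "f (A \<inter> S) + f (A \<union> S) \<le> f A + f S"
      using p S insert.prems by (intro submodularD(2)[OF f]) auto
    moreover have "A \<inter> S = A - {p}" "A \<union> S = insert p S" using True p insert.prems by auto
    ultimately have "f (A - {p}) + f (insert p S) \<le> f A + f S" by simp
    moreover have "sum ?v A = f (insert p S) - f S + sum ?v (A - {p})"
      using True fin by (simp add: sum.remove[of A p])
    ultimately show ?thesis using IH[OF \<open>A - {p} \<subseteq> S\<close>] by linarith
  qed
qed

lemma greedy_order:
  assumes "greedy n f z S v" "a \<in> S" "b \<in> {1..n} - S"
  shows "z a \<le> z b"
  using assms by (induction rule: greedy.induct) auto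

lemma greedy_bound:
  assumes "greedy n f z S v"
    and "\<And>S p. S \<subseteq> {1..n} \<Longrightarrow> p \<in> {1..n} - S \<Longrightarrow> \<bar>f (insert p S) - f S\<bar> \<le> C"
    and "i \<in> S"
  shows "\<bar>v i\<bar> \<le> C"
  using assms(1,3)
proof (induction rule: greedy.induct)
  case (insert S v p)
  then show ?case using assms(2)[OF greedy_subset[OF insert.hyps(1)] insert.hyps(2)] by auto
qed simp

text \<open>Summation by parts along the greedy order writes the inner product as a non-negative
  combination of values of \<open>f\<close>.\<close>

lemma greedy_inner_nonneg:
  assumes f: "submodular n f" "\<And>A. A \<subseteq> {1..n} \<Longrightarrow> 0 \<le> f A"
    and g: "\<And>i j. z i \<le> z j \<Longrightarrow> g j \<le> (g i :: int)"
    and "greedy n f z S v" "\<And>a. a \<in> S \<Longrightarrow> c \<le> g a"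
  shows "0 \<le> (\<Sum>a\<in>S. (g a - c) * v a)"
  using assms(4,5)
proof (induction arbitrary: c rule: greedy.induct)
  case empty
  then show ?case by simp
next
  case (insert S v p)
  let ?v = "v(p := f (insert p S) - f S)"
  have gr: "greedy n f z (insert p S) ?v" using insert.hyps by (rule greedy.insert)
  have fin: "finite S" using greedy_finite[OF insert.hyps(1)] .
  \<comment> \<open>The induction hypothesis is taken at \<open>c = g p\<close>, a lower bound for
    the earlier weights because earlier elements have smaller or equal \<open>z\<close> and
    \<open>g\<close> is antitone.\<close>
  have "0 \<le> (\<Sum>a\<in>S. (g a - g p) * v a)"
    using greedy_order[OF insert.hyps(1) _ insert.hyps(2)] by (intro insert.IH g)
  also have "\<dots> = (\<Sum>a\<in>S. (g a - g p) * ?v a)" using insert.hyps(2) by (intro sum.cong) auto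
  also have "\<dots> = (\<Sum>a\<in>insert p S. (g a - g p) * ?v a)" using fin insert.hyps(2) by simp
  finally have 1: "0 \<le> (\<Sum>a\<in>insert p S. (g a - g p) * ?v a)" .
  \<comment> \<open>What remains is the constant weight \<open>g p - c\<close> times the value of
    \<open>f\<close> on the whole prefix.\<close>
  have "sum ?v (insert p S) = f (insert p S)" by (rule greedy_sum_eq[OF f(1) gr])
  then have 2: "0 \<le> (g p - c) * sum ?v (insert p S)"
    using f(2)[OF greedy_subset[OF gr]] insert.prems[of p] by simp
  have "(\<Sum>a\<in>insert p S. (g a - c) * ?v a)
      = (\<Sum>a\<in>insert p S. (g a - g p) * ?v a + (g p - c) * ?v a)"
    by (intro sum.cong) (auto simp: algebra_simps)
  also have "\<dots> = (\<Sum>a\<in>insert p S. (g a - g p) * ?v a) + (g p - c) * sum ?v (insert p S)"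
    by (simp add: sum.distrib sum_distrib_left)
  finally show ?case using 1 2 by linarith
qed

text \<open>Blackwell's approachability strategy for the orthant: the greedy vertex that is added
  maximizes the inner product with the negative part of the sum so far.\<close>

inductive approach :: "nat \<Rightarrow> (nat set \<Rightarrow> int) \<Rightarrow> nat \<Rightarrow> (nat \<Rightarrow> int) \<Rightarrow> bool"
  for n f where
  zero: "(\<And>i. i \<in> {1..n} \<Longrightarrow> z i = 0) \<Longrightarrow> approach n f 0 z"
| step: "approach n f k z \<Longrightarrow> greedy n f z {1..n} v \<Longrightarrow>
    (\<And>i. i \<in> {1..n} \<Longrightarrow> z' i = z i + v i) \<Longrightarrow> approach n f (Suc k) z'"

text \<open>Each greedy vertex gives \<open>A\<close> at most \<open>f A\<close>, and
  \<open>z\<close> is a sum of \<open>k\<close> of them.\<close>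

lemma approach_sum_le:
  assumes f: "submodular n f" and "approach n f k z" and A: "A \<subseteq> {1..n}"
  shows "sum z A \<le> int k * f A"
  using assms(2)
proof (induction rule: approach.induct)
  case (zero z)
  then have "sum z A = 0" using A by (intro sum.neutral) blast
  then show ?case by simp
next
  case (step k z v z')
  have "sum z' A = (\<Sum>i\<in>A. z i + v i)" using step.hyps(3) A by (intro sum.cong) auto
  also have "\<dots> = sum z A + sum v A" by (rule sum.distrib)
  also have "\<dots> \<le> int k * f A + f A" by (intro add_mono step.IH greedy_sum_le[OF f step.hyps(2) A])
  finally show ?case by (simp add: algebra_simps)
qed

section \<open>Growth of the negative part\<close>

text \<open>The negative part of \<open>a + b\<close> is its distance to the non-negative half-line,
  hence at most its distance to the point \<open>max 0 a\<close>, which is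
  \<open>\<bar>max 0 (- a) - b\<bar>\<close>.\<close>

lemma neg_part_square_add:
  fixes a b :: int
  shows "(max 0 (- (a + b)))\<^sup>2 \<le> (max 0 (- a))\<^sup>2 - 2 * max 0 (- a) * b + b\<^sup>2"
proof -
  have "\<bar>max 0 (- (a + b))\<bar> \<le> \<bar>max 0 (- a) - b\<bar>" by auto
  then have "(max 0 (- (a + b)))\<^sup>2 \<le> (max 0 (- a) - b)\<^sup>2" by (rule abs_le_square_iff[THEN iffD1])
  then show ?thesis by (simp add: power2_diff algebra_simps)
qed

lemma approach_square_le:
  assumes f: "submodular n f" "\<And>A. A \<subseteq> {1..n} \<Longrightarrow> 0 \<le> f A"
    and C: "\<And>S p. S \<subseteq> {1..n} \<Longrightarrow> p \<in> {1..n} - S \<Longrightarrow> \<bar>f (insert p S) - f S\<bar> \<le> C"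
    and "approach n f k z"
  shows "(\<Sum>i\<in>{1..n}. (max 0 (- z i))\<^sup>2) \<le> int k * int n * C\<^sup>2"
  using assms(4)
proof (induction rule: approach.induct)
  case (zero z)
  then have "(\<Sum>i\<in>{1..n}. (max 0 (- z i))\<^sup>2) = 0" by (intro sum.neutral) auto
  then show ?case by simp
next
  case (step k z v z')
  let ?g = "\<lambda>i. max 0 (- z i)"
  have "(v i)\<^sup>2 \<le> C\<^sup>2" if "i \<in> {1..n}" for i
    using greedy_bound[OF step.hyps(2) C that] abs_le_square_iff[of "v i" C] by simp
  then have "(\<Sum>i\<in>{1..n}. (v i)\<^sup>2) \<le> (\<Sum>i\<in>{1..n}. C\<^sup>2)" by (rule sum_mono)
  then have vv: "(\<Sum>i\<in>{1..n}. (v i)\<^sup>2) \<le> int n * C\<^sup>2" by simp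
  \<comment> \<open>The negative part is antitone in \<open>z\<close> and bounded below by
    \<open>c = 0\<close>; so the cross term in the expansion of the square cannot increase
    it.\<close>
  have "0 \<le> (\<Sum>i\<in>{1..n}. (?g i - 0) * v i)"
    by (rule greedy_inner_nonneg[OF f _ step.hyps(2)]) auto
  then have inner: "0 \<le> (\<Sum>i\<in>{1..n}. ?g i * v i)" by simp
  have "(\<Sum>i\<in>{1..n}. (max 0 (- z' i))\<^sup>2) \<le> (\<Sum>i\<in>{1..n}. (?g i)\<^sup>2 - 2 * ?g i * v i + (v i)\<^sup>2)"
    using step.hyps(3) by (intro sum_mono) (simp only: neg_part_square_add)
  also have "\<dots> = (\<Sum>i\<in>{1..n}. (?g i)\<^sup>2) - 2 * (\<Sum>i\<in>{1..n}. ?g i * v i) + (\<Sum>i\<in>{1..n}. (v i)\<^sup>2)"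
    by (simp add: sum.distrib sum_subtractf sum_distrib_left mult.assoc)
  also have "\<dots> \<le> int k * int n * C\<^sup>2 + int n * C\<^sup>2" using step.IH inner vv by linarith
  finally show ?case by (simp add: algebra_simps)
qed

text \<open>Cauchy-Schwarz against the all-ones vector, obtained by summing
  \<open>2 * a * b \<le> a^2 + b^2\<close> over all pairs.\<close>

lemma sum_square_le_card_mult_sum_squares:
  fixes g :: "'a \<Rightarrow> int"
  shows "(sum g A)\<^sup>2 \<le> int (card A) * (\<Sum>i\<in>A. (g i)\<^sup>2)"
proof -
  have "2 * (sum g A)\<^sup>2 = 2 * (\<Sum>i\<in>A. \<Sum>j\<in>A. g i * g j)"
    by (simp only: power2_eq_square sum_product)
  also have "\<dots> = (\<Sum>i\<in>A. \<Sum>j\<in>A. 2 * g i * g j)"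
    by (simp only: sum_distrib_left mult.assoc)
  also have "\<dots> \<le> (\<Sum>i\<in>A. \<Sum>j\<in>A. (g i)\<^sup>2 + (g j)\<^sup>2)"
  proof (intro sum_mono)
    show "2 * g i * g j \<le> (g i)\<^sup>2 + (g j)\<^sup>2" for i j
      using zero_le_power2[of "g i - g j"] by (simp add: power2_diff)
  qed
  also have "\<dots> = 2 * (int (card A) * (\<Sum>i\<in>A. (g i)\<^sup>2))"
    by (simp add: sum.distrib sum_distrib_left)
  finally show ?thesis by simp
qed

text \<open>A violated set forces a negative part of size at least \<open>k\<close>, while for \<open>f \<ge> 0\<close> it grows
  only like the square root of \<open>k\<close>.\<close>

lemma approach_decides_nonneg:
  assumes f: "submodular n f"
    and C: "\<And>S p. S \<subseteq> {1..n} \<Longrightarrow> p \<in> {1..n} - S \<Longrightarrow> \<bar>f (insert p S) - f S\<bar> \<le> C"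
    and z: "approach n f k z" and k: "(int n)\<^sup>2 * C\<^sup>2 < int k"
  shows "(\<Sum>i\<in>{1..n}. max 0 (- z i)) < int k \<longleftrightarrow> (\<forall>A. A \<subseteq> {1..n} \<longrightarrow> 0 \<le> f A)"
proof
  assume less: "(\<Sum>i\<in>{1..n}. max 0 (- z i)) < int k"
  show "\<forall>A. A \<subseteq> {1..n} \<longrightarrow> 0 \<le> f A"
  proof (intro allI impI, rule ccontr)
    fix A assume A: "A \<subseteq> {1..n}" and "\<not> 0 \<le> f A"
    \<comment> \<open>Integrality turns a violation into a deficit of at least one per
      round.\<close>
    then have "f A \<le> - 1" by simp
    then have "int k * f A \<le> int k * (- 1)" by (rule mult_left_mono) simp
    then have "int k \<le> - sum z A" using approach_sum_le[OF f z A] by linarith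
    also have "\<dots> = (\<Sum>i\<in>A. - z i)" by (simp add: sum_negf)
    also have "\<dots> \<le> (\<Sum>i\<in>A. max 0 (- z i))" by (intro sum_mono) auto
    also have "\<dots> \<le> (\<Sum>i\<in>{1..n}. max 0 (- z i))" using A by (intro sum_mono2) auto
    finally show False using less by simp
  qed
next
  assume nonneg: "\<forall>A. A \<subseteq> {1..n} \<longrightarrow> 0 \<le> f A"
  let ?e = "\<Sum>i\<in>{1..n}. max 0 (- z i)"
  have "?e\<^sup>2 \<le> int n * (\<Sum>i\<in>{1..n}. (max 0 (- z i))\<^sup>2)"
    using sum_square_le_card_mult_sum_squares[of "\<lambda>i. max 0 (- z i)" "{1..n}"] by simp
  also have "\<dots> \<le> int n * (int k * int n * C\<^sup>2)"
    using nonneg by (intro mult_left_mono approach_square_le[OF f _ C z]) auto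
  also have "\<dots> = int k * ((int n)\<^sup>2 * C\<^sup>2)" by (simp add: power2_eq_square algebra_simps)
  \<comment> \<open>Strictness needs \<open>0 < int k\<close>, which follows from the hypothesis
    \<open>k\<close> because its left side is non-negative.\<close>
  also have "\<dots> < int k * int k"
    using k by (intro mult_strict_left_mono le_less_trans[OF _ k]) auto
  finally have "?e\<^sup>2 < (int k)\<^sup>2" by (simp add: power2_eq_square)
  then show "?e < int k" by (rule power2_less_imp_less) simp
qed

section \<open>Testing whether a brick fits\<close>

text \<open>\<open>w\<close> is the current vector with the tentative brick and without the load, so
  \<open>r A - sum w A\<close> is the slack of \<open>A\<close> after the brick; it is non-negative
  everywhere exactly if the brick fits.\<close>

lemma extension_test:
  assumes r: "rank_function n r" and l: "l \<in> nonneg_vecs n"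
    and y: "y \<in> polymatroid n (lifted_rank r l)" and i: "i \<in> {1..n}"
    and M: "int M = lifted_rank r l {1..n}"
    and w: "\<And>j. j \<in> {1..n} \<Longrightarrow> w j = y j - l j + of_bool (j = i)"
    and z: "approach n (\<lambda>A. r A - sum w A) T z"
    and T: "(int n)\<^sup>2 * (int M + 1)\<^sup>2 < int T"
  shows "(\<Sum>i\<in>{1..n}. max 0 (- z i)) < int T \<longleftrightarrow> y + unit_vec i \<in> polymatroid n (lifted_rank r l)"
proof -
  let ?R = "lifted_rank r l"
  define f where "f A = r A - sum w A" for A
  have R: "rank_function n ?R" by (rule rank_function_lifted_rank[OF r l])
  have fin: "finite A" if "A \<subseteq> {1..n}" for A using finite_subset[OF that] by simp
  have f: "f A = ?R A - sum (y + unit_vec i) A" if A: "A \<subseteq> {1..n}" for A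
  proof -
    have "sum w A = (\<Sum>j\<in>A. (y + unit_vec i) j - l j)"
      using A w by (intro sum.cong) (auto simp: unit_vec_def)
    then show ?thesis by (simp add: f_def lifted_rank_def sum_subtractf)
  qed
  have "submodular n f"
    unfolding submodular_def
  proof (intro conjI allI impI)
    show "f {} = 0" using rank_functionD(1)[OF r] by (simp add: f_def)
    fix A B assume AB: "A \<subseteq> {1..n} \<and> B \<subseteq> {1..n}"
    have "sum w (A \<union> B) + sum w (A \<inter> B) = sum w A + sum w B"
      using AB fin by (intro sum.union_inter) auto
    then show "f (A \<inter> B) + f (A \<union> B) \<le> f A + f B"
      using rank_functionD(4)[OF r, of A B] AB unfolding f_def by simp
  qed
  \<comment> \<open>The constant \<open>M + 1\<close> arises because a marginal of the lifted rank
    function lies between \<open>0\<close> and \<open>M\<close>, and an entry of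
    \<open>y + unit_vec i\<close> between \<open>0\<close> and \<open>M + 1\<close>.\<close>
  moreover have "\<bar>f (insert p S) - f S\<bar> \<le> int M + 1" if S: "S \<subseteq> {1..n}" and p: "p \<in> {1..n} - S" for S p
  proof -
    have S': "insert p S \<subseteq> {1..n}" using S p by auto
    have "?R S \<le> ?R (insert p S)" "?R (insert p S) \<le> ?R {1..n}" "0 \<le> ?R S"
      using S S' by (auto intro!: rank_functionD(2,3)[OF R])
    moreover have "f (insert p S) - f S = ?R (insert p S) - ?R S - (y p + unit_vec i p)"
      using f[OF S] f[OF S'] fin[OF S] p by simp
    moreover have "0 \<le> y p" using y p by (simp add: polymatroid_def nonneg_vecs_def)
    moreover have "y p \<le> ?R {p}"
    proof -
      have "sum y {p} \<le> ?R {p}" using y p unfolding polymatroid_def by blast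
      then show ?thesis by simp
    qed
    moreover have "?R {p} \<le> ?R {1..n}" using p by (intro rank_functionD(3)[OF R]) auto
    moreover have "0 \<le> unit_vec i p" "unit_vec i p \<le> 1" by (auto simp: unit_vec_def)
    ultimately show ?thesis using M by linarith
  qed
  moreover have "approach n f T z" using z unfolding f_def .
  ultimately have "(\<Sum>i\<in>{1..n}. max 0 (- z i)) < int T \<longleftrightarrow> (\<forall>A. A \<subseteq> {1..n} \<longrightarrow> 0 \<le> f A)"
    by (rule approach_decides_nonneg[OF _ _ _ T])
  also have "\<dots> \<longleftrightarrow> (\<forall>A. A \<subseteq> {1..n} \<longrightarrow> sum (y + unit_vec i) A \<le> ?R A)"
    using f by auto
  also have "\<dots> \<longleftrightarrow> y + unit_vec i \<in> polymatroid n ?R"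
  proof -
    have "y + unit_vec i \<in> nonneg_vecs n"
      using y i by (auto simp: polymatroid_def nonneg_vecs_def unit_vec_def)
    then show ?thesis by (simp add: polymatroid_def)
  qed
  finally show ?thesis .
qed

section \<open>Time-bounded total correctness\<close>

text \<open>Total correctness with a time budget. The budget is only an upper bound, so branches of
  different cost can share it.\<close>

definition wp ::
  "nat \<Rightarrow> (nat set \<Rightarrow> int) \<Rightarrow> (nat \<Rightarrow> nat set \<Rightarrow> nat) \<Rightarrow> com \<Rightarrow> nat \<Rightarrow> (state \<Rightarrow> bool) \<Rightarrow> state \<Rightarrow> bool"
where
  "wp n r \<tau> c t Q s \<longleftrightarrow> (\<exists>t' s'. exec n r \<tau> c s t' s' \<and> t' \<le> t \<and> Q s')"

fun writes :: "com \<Rightarrow> vname set" where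
  "writes Skip = {}"
| "writes (Assign v e f) = {v}"
| "writes (Rank v a) = {v}"
| "writes (Tie v k a) = {v}"
| "writes (Seq c d) = writes c \<union> writes d"
| "writes (Cond b c d) = writes c \<union> writes d"
| "writes (While b c) = writes c"

lemma store_same [simp]: "store s v i z v j = (if j = i then z else s v j)"
  by (simp add: store_def)

lemma store_other [simp]: "w \<noteq> v \<Longrightarrow> store s v i z w = s w"
  by (simp add: store_def)

lemma exec_unwritten: "exec n r \<tau> c s t s' \<Longrightarrow> v \<notin> writes c \<Longrightarrow> s' v = s v"
  by (induction rule: exec.induct) (auto simp: store_def)

text \<open>The frame property is built in: arrays that \<open>c\<close> does not write keep their
  content, so specifications of subprograms mention only what changes.\<close>

lemma wp_conseq:
  assumes "wp n r \<tau> c t Q s" "t \<le> t'"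
    and "\<And>s'. Q s' \<Longrightarrow> (\<And>v. v \<notin> writes c \<Longrightarrow> s' v = s v) \<Longrightarrow> Q' s'"
  shows "wp n r \<tau> c t' Q' s"
proof -
  from assms(1) obtain t1 s1 where "exec n r \<tau> c s t1 s1" "t1 \<le> t" "Q s1" by (auto simp: wp_def)
  then show ?thesis
    unfolding wp_def using exec_unwritten assms(2,3) by (metis order_trans)
qed

lemma wp_time: "wp n r \<tau> c t Q s \<Longrightarrow> t \<le> t' \<Longrightarrow> wp n r \<tau> c t' Q s"
  using wp_conseq by blast

lemma wp_Skip: "Q s \<Longrightarrow> wp n r \<tau> Skip 1 Q s"
  unfolding wp_def using exec.Skip by blast

lemma wp_Assign: "Q (store s v (aval e s) (aval f s)) \<Longrightarrow> wp n r \<tau> (Assign v e f) 1 Q s"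
  unfolding wp_def using exec.Assign by blast

lemma wp_Rank: "Q (store s v 0 (r (stored_set n s a))) \<Longrightarrow> wp n r \<tau> (Rank v a) 1 Q s"
  unfolding wp_def using exec.Rank by blast

lemma wp_Tie:
  "Q (store s v 0 (int (\<tau> (nat (s k 0)) (stored_set n s a)))) \<Longrightarrow> wp n r \<tau> (Tie v k a) 1 Q s"
  unfolding wp_def using exec.Tie by blast

lemma wp_Seq:
  assumes "wp n r \<tau> c1 t1 (\<lambda>s'. wp n r \<tau> c2 t2 Q s') s"
  shows "wp n r \<tau> (Seq c1 c2) (t1 + t2) Q s"
proof -
  from assms obtain u1 s1 where 1: "exec n r \<tau> c1 s u1 s1" "u1 \<le> t1" and "wp n r \<tau> c2 t2 Q s1"
    by (auto simp: wp_def)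
  then obtain u2 s2 where 2: "exec n r \<tau> c2 s1 u2 s2" "u2 \<le> t2" "Q s2"
    by (auto simp: wp_def)
  show ?thesis
    unfolding wp_def using exec.Seq[OF 1(1) 2(1)] 1(2) 2(2,3) by (meson add_mono)
qed

lemma wp_Cond:
  assumes "bval b s \<Longrightarrow> wp n r \<tau> c1 1 Q s" "\<not> bval b s \<Longrightarrow> wp n r \<tau> c2 1 Q s"
  shows "wp n r \<tau> (Cond b c1 c2) 2 Q s"
proof (cases "bval b s")
  case True
  then obtain u s1 where "exec n r \<tau> c1 s u s1" "u \<le> 1" "Q s1"
    using assms(1) by (auto simp: wp_def)
  then show ?thesis
    unfolding wp_def using exec.CondTrue[OF True] by (intro exI[of _ "1 + u"] exI[of _ s1]) auto
next
  case False
  then obtain u s1 where "exec n r \<tau> c2 s u s1" "u \<le> 1" "Q s1"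
    using assms(2) by (auto simp: wp_def)
  then show ?thesis
    unfolding wp_def using exec.CondFalse[OF False] by (intro exI[of _ "1 + u"] exI[of _ s1]) auto
qed

text \<open>The number of iterations is known in advance, so an invariant indexed by the finished
  ones yields termination and cost: a body and a test for each remaining iteration, and the final
  failing test.\<close>

lemma wp_While_count:
  assumes step: "\<And>k s. k < N \<Longrightarrow> I k s \<Longrightarrow> bval b s \<and> wp n r \<tau> c t (I (Suc k)) s"
    and stop: "\<And>s. I N s \<Longrightarrow> \<not> bval b s"
    and "I k s" "k \<le> N"
  shows "wp n r \<tau> (While b c) ((N - k) * (t + 1) + 1) (I N) s"
  using assms(4,3)
proof (induction arbitrary: s rule: inc_induct)
  case base
  then show ?case unfolding wp_def using exec.WhileFalse[OF stop] by fastforce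
next
  case (step k)
  have b: "bval b s" and "wp n r \<tau> c t (I (Suc k)) s"
    using assms(1)[OF step.hyps(2) step.prems] by auto
  then obtain t1 s1 where 1: "exec n r \<tau> c s t1 s1" "t1 \<le> t" "I (Suc k) s1" by (auto simp: wp_def)
  obtain t2 s2 where 2: "exec n r \<tau> (While b c) s1 t2 s2" "t2 \<le> (N - Suc k) * (t + 1) + 1" "I N s2"
    using step.IH[OF 1(3)] by (auto simp: wp_def)
  have "N - k = Suc (N - Suc k)" using step.hyps by simp
  then have "1 + t1 + t2 \<le> (N - k) * (t + 1) + 1" using 1(2) 2(2) by simp
  then show ?case unfolding wp_def using exec.WhileTrue[OF b 1(1) 2(1)] 2(3) by blast
qed

section \<open>Counting loops\<close>

abbreviation V :: "vname \<Rightarrow> aexp" where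
  "V v \<equiv> Cell v (Num 0)"

abbreviation Set :: "vname \<Rightarrow> aexp \<Rightarrow> com" where
  "Set v e \<equiv> Assign v (Num 0) e"

text \<open>The counter is raised before the body runs, so the body sees the values from
  \<open>1\<close> up to the limit, which is the index range of vectors.\<close>

definition For :: "vname \<Rightarrow> vname \<Rightarrow> com \<Rightarrow> com" where
  "For v u c = Seq (Set v (Num 0))
     (While (Less (V v) (V u)) (Seq (Set v (Plus (V v) (Num 1))) c))"

lemma writes_For [simp]: "writes (For v u c) = insert v (writes c)"
  by (simp add: For_def)

text \<open>Each iteration pays one unit for the test and one for the increment; initialization and
  final test account for the last two. The rule itself tracks the counter and the unwritten
  arrays.\<close>

lemma wp_For:
  assumes v: "v \<noteq> u" "v \<notin> writes c" "u \<notin> writes c" and N: "s u 0 = int N"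
    and init: "I 0 (store s v 0 0)"
    and step: "\<And>k s'. k < N \<Longrightarrow> I k s' \<Longrightarrow> (\<And>w. w \<noteq> v \<Longrightarrow> w \<notin> writes c \<Longrightarrow> s' w = s w) \<Longrightarrow>
      wp n r \<tau> c t (I (Suc k)) (store s' v 0 (int (Suc k)))"
    and exit: "\<And>s'. I N s' \<Longrightarrow> (\<And>w. w \<noteq> v \<Longrightarrow> w \<notin> writes c \<Longrightarrow> s' w = s w) \<Longrightarrow> Q s'"
  shows "wp n r \<tau> (For v u c) (N * (t + 2) + 2) Q s"
proof -
  define J where "J k s' \<longleftrightarrow> I k s' \<and> s' v 0 = int k \<and> (\<forall>w. w \<noteq> v \<and> w \<notin> writes c \<longrightarrow> s' w = s w)"
    for k s'
  have Ju: "s' u 0 = int N" if "J k s'" for k s'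
    using that v N by (auto simp: J_def)
  have J0: "J 0 (store s v 0 0)" using init by (auto simp: J_def store_def)
  have step': "bval (Less (V v) (V u)) s' \<and>
      wp n r \<tau> (Seq (Set v (Plus (V v) (Num 1))) c) (1 + t) (J (Suc k)) s'"
    if k: "k < N" "J k s'" for k s'
  proof
    show "bval (Less (V v) (V u)) s'" using k Ju[OF k(2)] by (simp add: J_def)
    have "wp n r \<tau> c t (I (Suc k)) (store s' v 0 (int (Suc k)))"
      using k step by (simp add: J_def)
    then have "wp n r \<tau> c t (J (Suc k)) (store s' v 0 (int (Suc k)))"
      by (rule wp_conseq) (use k v in \<open>auto simp: J_def store_def\<close>)
    then show "wp n r \<tau> (Seq (Set v (Plus (V v) (Num 1))) c) (1 + t) (J (Suc k)) s'"
      using k by (intro wp_Seq wp_Assign) (simp add: J_def add.commute)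
  qed
  have stop': "\<not> bval (Less (V v) (V u)) s'" if "J N s'" for s'
    using that Ju[OF that] by (simp add: J_def)
  have "wp n r \<tau> (While (Less (V v) (V u)) (Seq (Set v (Plus (V v) (Num 1))) c))
      ((N - 0) * (1 + t + 1) + 1) (J N) (store s v 0 0)"
    by (rule wp_While_count[where I = J]) (fact step' stop' J0 le0)+
  then have "wp n r \<tau> (For v u c) (1 + ((N - 0) * (1 + t + 1) + 1)) (J N) s"
    unfolding For_def by (intro wp_Seq wp_Assign) simp
  then show ?thesis
    by (rule wp_conseq) (auto simp: J_def intro!: exit)
qed

section \<open>A program for Brick-Laying\<close>

text \<open>Array \<open>x\<close> holds the current vector minus the load, so that it ends up as the output and
  \<open>r A - x(A)\<close> is the slack of \<open>A\<close> without access to the lifted rank function. In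
  \<open>add_greedy\<close>, \<open>s\<close> is the prefix of the greedy order built so far; entries of \<open>z\<close> outside it are
  still the old ones, so \<open>z\<close> can be updated in place. In \<open>lay_brick\<close>, index \<open>i\<close> gets the key
  \<open>g i\<close>, its height if a brick may be placed on it and the unattainable height \<open>m + 1\<close> otherwise,
  where \<open>m\<close> is the total number of bricks.\<close>

definition find_min :: com where
  "find_min = Seq (Set ''p'' (Num 0)) (For ''j'' ''n''
     (Cond (Conj (Less (Cell ''s'' (V ''j'')) (Num 1))
              (Neg (Conj (Less (Num 0) (V ''p''))
                 (Neg (Less (Cell ''z'' (V ''j'')) (Cell ''z'' (V ''p'')))))))
        (Set ''p'' (V ''j'')) Skip))"

definition add_greedy :: com where
  "add_greedy = Seq (For ''j'' ''n'' (Assign ''s'' (V ''j'') (Num 0))) (Seq (Set ''q'' (Num 0))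
     (For ''d'' ''n'' (Seq find_min (Seq (Assign ''s'' (V ''p'') (Num 1)) (Seq (Rank ''o'' ''s'')
        (Seq (Assign ''z'' (V ''p'')
            (Plus (Cell ''z'' (V ''p''))
              (Minus (V ''o'') (Plus (V ''q'') (Cell ''x'' (V ''p''))))))
          (Set ''q'' (V ''o''))))))))"

definition negativity :: com where
  "negativity = Seq (For ''j'' ''n'' (Assign ''z'' (V ''j'') (Num 0)))
     (Seq (For ''c'' ''t'' add_greedy) (Seq (Set ''e'' (Num 0))
       (For ''j'' ''n'' (Cond (Less (Cell ''z'' (V ''j'')) (Num 0))
          (Set ''e'' (Minus (V ''e'') (Cell ''z'' (V ''j'')))) Skip))))"

definition lay_brick :: com where
  "lay_brick = Seq (Set ''b'' (Plus (V ''m'') (Num 1)))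
     (Seq (For ''i'' ''n''
       (Seq (Assign ''x'' (V ''i'') (Plus (Cell ''x'' (V ''i'')) (Num 1)))
       (Seq negativity
       (Seq (Assign ''x'' (V ''i'') (Minus (Cell ''x'' (V ''i'')) (Num 1)))
       (Seq (Cond (Less (V ''e'') (V ''t''))
              (Assign ''g'' (V ''i'') (Plus (Cell ''x'' (V ''i'')) (Cell ''l'' (V ''i''))))
              (Assign ''g'' (V ''i'') (Plus (V ''m'') (Num 1))))
            (Cond (Less (Cell ''g'' (V ''i'')) (V ''b''))
              (Set ''b'' (Cell ''g'' (V ''i''))) Skip))))))
     (Seq (For ''i'' ''n'' (Cond (Less (V ''b'') (Cell ''g'' (V ''i'')))
            (Assign ''a'' (V ''i'') (Num 0)) (Assign ''a'' (V ''i'') (Num 1))))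
     (Seq (Set ''o'' (Minus (V ''k'') (Num 1)))
     (Seq (Tie ''p'' ''o'' ''a'')
          (Assign ''x'' (V ''p'') (Plus (Cell ''x'' (V ''p'')) (Num 1)))))))"

text \<open>\<open>m\<close> and \<open>u\<close> start at zero by \<open>input_state\<close>. As
  expressions have no multiplication, \<open>u = n * (m + 1)\<close> and the number of rounds
  \<open>t = 1 + u * u\<close> are built by repeated addition.\<close>

definition brick_laying :: com where
  "brick_laying = Seq (For ''i'' ''n''
       (Seq (Assign ''s'' (V ''i'') (Num 1))
       (Seq (Assign ''x'' (V ''i'') (Minus (Num 0) (Cell ''l'' (V ''i''))))
            (Set ''m'' (Plus (V ''m'') (Cell ''l'' (V ''i'')))))))
     (Seq (Rank ''q'' ''s'')
     (Seq (Set ''m'' (Plus (V ''m'') (V ''q'')))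
     (Seq (Set ''b'' (Plus (V ''m'') (Num 1)))
     (Seq (For ''i'' ''n'' (Set ''u'' (Plus (V ''u'') (V ''b''))))
     (Seq (Set ''t'' (Num 1))
     (Seq (For ''i'' ''u'' (Set ''t'' (Plus (V ''t'') (V ''u''))))
          (For ''k'' ''m'' lay_brick)))))))"

section \<open>Running-time bounds\<close>

text \<open>The bounds follow the nesting of the commands, so that the \<open>wp\<close> rules
  produce them literally. Over an arbitrary commutative semiring the same term can be read as a
  number and as a polynomial.\<close>

definition add_greedy_time :: "'a::comm_semiring_1 \<Rightarrow> 'a" where
  "add_greedy_time n = (3 * n + 2) + (1 + (n * ((4 * n + 3) + (1 + (1 + (1 + 1))) + 2) + 2))"

definition negativity_time :: "'a::comm_semiring_1 \<Rightarrow> 'a \<Rightarrow> 'a" where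
  "negativity_time n t =
     (3 * n + 2) + ((t * (add_greedy_time n + 2) + 2) + (1 + (n * (2 + 2) + 2)))"

definition lay_brick_time :: "'a::comm_semiring_1 \<Rightarrow> 'a \<Rightarrow> 'a" where
  "lay_brick_time n t = 1 + ((n * ((1 + (negativity_time n t + (1 + (2 + 2)))) + 2) + 2)
     + ((n * (2 + 2) + 2) + (1 + (1 + 1))))"

definition brick_laying_time :: "'a::comm_semiring_1 \<Rightarrow> 'a \<Rightarrow> 'a" where
  "brick_laying_time n m =
     (let u = n * (m + 1) in
      (n * ((1 + (1 + 1)) + 2) + 2) + (1 + (1 + (1 + ((n * (1 + 2) + 2) + (1 + ((u * (1 + 2) + 2)
        + (m * (lay_brick_time n (1 + u * u) + 2) + 2))))))))"

section \<open>Verification of the program\<close>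

lemma writes_find_min [simp]: "writes find_min = {''p'', ''j''}"
  by (auto simp: find_min_def)

lemma writes_add_greedy [simp]:
  "writes add_greedy = {''p'', ''j'', ''s'', ''q'', ''d'', ''o'', ''z''}"
  by (auto simp: add_greedy_def)

lemma writes_negativity [simp]:
  "writes negativity = {''p'', ''j'', ''s'', ''q'', ''d'', ''o'', ''z'', ''c'', ''e''}"
  by (auto simp: negativity_def)

lemma writes_lay_brick [simp]:
  "writes lay_brick = {''p'', ''j'', ''s'', ''q'', ''d'', ''o'', ''z'', ''c'', ''e'',
     ''b'', ''i'', ''x'', ''g'', ''a''}"
  by (auto simp: lay_brick_def)

text \<open>The value \<open>0\<close> is a sentinel for "no index outside \<open>S\<close> seen so
  far"; it cannot clash with an index, as these start at \<open>1\<close>.\<close>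

definition least_outside :: "(nat \<Rightarrow> int) \<Rightarrow> nat set \<Rightarrow> nat \<Rightarrow> nat \<Rightarrow> bool" where
  "least_outside z S k p \<longleftrightarrow> p = 0 \<and> {1..k} \<subseteq> S \<or> p \<in> {1..k} - S \<and> (\<forall>i\<in>{1..k} - S. z p \<le> z i)"

lemma least_outside_Suc:
  assumes "least_outside z S k p"
  defines "b \<equiv> Suc k \<notin> S \<and> \<not> (0 < p \<and> \<not> z (Suc k) < z p)"
  shows "b \<Longrightarrow> least_outside z S (Suc k) (Suc k)" "\<not> b \<Longrightarrow> least_outside z S (Suc k) p"
proof -
  have *: "{1..Suc k} = insert (Suc k) {1..k}" by auto
  show "least_outside z S (Suc k) (Suc k)" if b
    using assms(1) that unfolding b_def least_outside_def *
    by (cases "p = 0") (auto intro: less_imp_le less_le_trans)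
  show "least_outside z S (Suc k) p" if "\<not> b"
    using assms(1) that unfolding b_def least_outside_def * by (cases "p = 0") auto
qed

lemma wp_find_min:
  assumes s: "s ''n'' 0 = int n" "\<And>i. i \<in> {1..n} \<Longrightarrow> s ''s'' (int i) = of_bool (i \<in> S)"
    and S: "\<not> {1..n} \<subseteq> S"
  shows "wp n r \<tau> find_min (4 * n + 3)
    (\<lambda>s'. \<exists>p\<in>{1..n} - S. s' ''p'' 0 = int p \<and>
       (\<forall>i\<in>{1..n} - S. s ''z'' (int p) \<le> s ''z'' (int i))) s"
proof -
  let ?z = "\<lambda>i. s ''z'' (int i)"
  define I where "I k s' \<longleftrightarrow> 0 \<le> s' ''p'' 0 \<and> least_outside ?z S k (nat (s' ''p'' 0))"
    for k and s' :: state
  show ?thesis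
    unfolding find_min_def
    apply (rule wp_time)
     apply (rule wp_Seq wp_Assign)+
     apply (rule wp_For[where I = I and N = n and t = 2])
           apply (simp_all add: s)[4]
       apply (simp add: I_def least_outside_def)
    subgoal premises prems for k s'
    proof -
      define p where "p = nat (s' ''p'' 0)"
      have p: "s' ''p'' 0 = int p" "least_outside ?z S k p"
        using prems(2) by (auto simp: I_def p_def)
      have fr: "s' ''s'' = s ''s''" "s' ''z'' = s ''z''" using prems(3) by simp_all
      have nat: "nat (1 + int k) = Suc k" by simp
      have S: "s ''s'' (1 + int k) = of_bool (Suc k \<in> S)" using s(2)[of "Suc k"] prems(1) by simp
      show ?thesis
      proof (intro wp_Cond wp_Assign wp_Skip)
        let ?s = "store s' ''j'' 0 (int (Suc k))"
        let ?b = "Conj (Less (Cell ''s'' (V ''j'')) (Num 1))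
              (Neg (Conj (Less (Num 0) (V ''p''))
                 (Neg (Less (Cell ''z'' (V ''j'')) (Cell ''z'' (V ''p''))))))"
        have b: "bval ?b ?s \<longleftrightarrow> Suc k \<notin> S \<and> \<not> (0 < p \<and> \<not> ?z (Suc k) < ?z p)"
          by (simp add: fr p S)
        show "I (Suc k) (store ?s ''p'' (aval (Num 0) ?s) (aval (V ''j'') ?s))" if "bval ?b ?s"
          using least_outside_Suc(1)[OF p(2)] that unfolding b by (simp add: I_def nat)
        show "I (Suc k) ?s" if "\<not> bval ?b ?s"
          using least_outside_Suc(2)[OF p(2)] that unfolding b by (simp add: I_def p)
      qed
    qed
    subgoal premises prems for s'
    proof -
      define p where "p = nat (s' ''p'' 0)"
      have p: "s' ''p'' 0 = int p" "least_outside ?z S n p"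
        using prems(1) by (auto simp: I_def p_def)
      then have "p \<in> {1..n} - S \<and> (\<forall>i\<in>{1..n} - S. ?z p \<le> ?z i)"
        using S unfolding least_outside_def by blast
      then show ?thesis using p(1) by blast
    qed
    apply simp
    done
qed

lemma wp_zero:
  assumes "s ''n'' 0 = int n" "v \<noteq> ''j''" "v \<noteq> ''n''"
  shows "wp n r \<tau> (For ''j'' ''n'' (Assign v (V ''j'') (Num 0))) (3 * n + 2)
    (\<lambda>s'. \<forall>i\<in>{1..n}. s' v (int i) = 0) s"
proof -
  define I where "I k s' \<longleftrightarrow> (\<forall>i\<in>{1..k}. s' v (int i) = 0)" for k :: nat and s' :: state
  have "wp n r \<tau> (For ''j'' ''n'' (Assign v (V ''j'') (Num 0))) (n * (1 + 2) + 2)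
    (\<lambda>s'. \<forall>i\<in>{1..n}. s' v (int i) = 0) s"
  proof (rule wp_For[where I = I])
    fix k s' assume "I k s'"
    then have "I (Suc k) (store (store s' ''j'' 0 (int (Suc k))) v (int (Suc k)) 0)"
      using assms(2) by (auto simp: I_def le_Suc_eq)
    then show "wp n r \<tau> (Assign v (V ''j'') (Num 0)) 1 (I (Suc k)) (store s' ''j'' 0 (int (Suc k)))"
      by (intro wp_Assign) simp
  qed (use assms in \<open>auto simp: I_def\<close>)
  then show ?thesis by (rule wp_time) simp
qed

lemma wp_add_greedy:
  assumes n: "s ''n'' 0 = int n" and r: "r {} = 0"
  defines "f \<equiv> \<lambda>A. r A - (\<Sum>i\<in>A. s ''x'' (int i))" and "z \<equiv> \<lambda>i. s ''z'' (int i)"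
  shows "wp n r \<tau> add_greedy (add_greedy_time n)
    (\<lambda>s'. \<exists>v. greedy n f z {1..n} v \<and> (\<forall>i\<in>{1..n}. s' ''z'' (int i) = z i + v i)) s"
proof -
  \<comment> \<open>\<open>q\<close> caches the rank of the current prefix; its initial value
    \<open>0\<close> is correct because \<open>r {} = 0\<close>.\<close>
  define I where "I k s' \<longleftrightarrow> (\<exists>S v. greedy n f z S v \<and> card S = k \<and>
      (\<forall>i\<in>{1..n}. s' ''s'' (int i) = of_bool (i \<in> S)) \<and> s' ''q'' 0 = r S \<and>
      (\<forall>i\<in>{1..n}. s' ''z'' (int i) = z i + v i))" for k s'
  show ?thesis
    unfolding add_greedy_def add_greedy_time_def
    apply (rule wp_Seq)
    apply (rule wp_conseq[OF wp_zero[where s = s, OF n] order_refl], simp, simp)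
    apply (rule wp_Seq, rule wp_Assign)
    apply (rule wp_For[where I = I])
          apply (simp_all add: n)[4]
    subgoal premises prems for s1
    proof -
      have "greedy n f z {} (\<lambda>_. 0)" by (rule greedy.empty)
      moreover have "s1 ''z'' = s ''z''" using prems(2) by simp
      ultimately show ?thesis
        unfolding I_def using prems(1) r
        by (intro exI[of _ "{}"] exI[of _ "\<lambda>_. 0"]) (simp add: z_def)
    qed
    subgoal premises prems for s1 k s2
    proof -
      from prems(4) obtain S v where S: "greedy n f z S v" "card S = k"
        "\<And>i. i \<in> {1..n} \<Longrightarrow> s2 ''s'' (int i) = of_bool (i \<in> S)" "s2 ''q'' 0 = r S"
        "\<And>i. i \<in> {1..n} \<Longrightarrow> s2 ''z'' (int i) = z i + v i"
        unfolding I_def by blast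
      have "s2 ''n'' = s1 ''n''" "s2 ''x'' = s1 ''x''" using prems(5) by simp_all
      moreover have "s1 ''n'' = s ''n''" "s1 ''x'' = s ''x''" using prems(2) by simp_all
      ultimately have fr: "s2 ''n'' 0 = int n" "s2 ''x'' = s ''x''" using n by simp_all
      have "S \<noteq> {1..n}" using S(2) prems(3) by auto
      then have notS: "\<not> {1..n} \<subseteq> S" using greedy_subset[OF S(1)] by auto
      show ?thesis
        apply (rule wp_Seq)
        apply (rule wp_conseq[OF wp_find_min[where S = S] order_refl])
           apply (simp add: fr)
          apply (simp add: S)
         apply (rule notS)
        subgoal premises prems for s3
        proof -
          from prems(1) obtain p where p: "p \<in> {1..n} - S" "s3 ''p'' 0 = int p"
            "\<And>i. i \<in> {1..n} - S \<Longrightarrow> s2 ''z'' (int p) \<le> s2 ''z'' (int i)" by auto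
          have fr3: "s3 ''s'' = s2 ''s''" "s3 ''z'' = s2 ''z''" "s3 ''q'' = s2 ''q''" "s3 ''x'' = s ''x''"
            using prems(2) fr by simp_all
          define v' where "v' = v(p := f (insert p S) - f S)"
          have v0: "v i = 0" if "i \<notin> S" for i using greedy_outside[OF S(1) that] .
          \<comment> \<open>\<open>v\<close> vanishes outside \<open>S\<close>, so the entries
            compared by \<open>find_min\<close> are still those of the original \<open>z\<close>,
            although the array is updated in place.\<close>
          have "z p \<le> z i" if "i \<in> {1..n} - S" for i
            using p(1) p(3)[OF that] S(5)[of p] S(5)[of i] that v0[of p] v0[of i] by simp
          then have gr: "greedy n f z (insert p S) v'"
            unfolding v'_def by (intro greedy.insert S(1) p(1))
          have finS: "finite S" using greedy_finite[OF S(1)] .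
          \<comment> \<open>A marginal of \<open>f\<close> is the difference of two successive
            oracle answers minus one entry of \<open>x\<close>, so one query per element
            suffices.\<close>
          then have fp: "f (insert p S) - f S = r (insert p S) - (r S + s ''x'' (int p))"
            using p(1) by (simp add: f_def)
          define s4 where "s4 = store s3 ''s'' (int p) 1"
          have s4: "s4 ''s'' (int i) = of_bool (i \<in> insert p S)" if "i \<in> {1..n}" for i
            using S(3)[OF that] by (simp add: s4_def fr3)
          then have st: "stored_set n s4 ''s'' = insert p S"
            using greedy_subset[OF gr] by (auto simp: stored_set_def)
          define s6 where "s6 = store (store s4 ''o'' 0 (r (insert p S))) ''z'' (int p)
              (s3 ''z'' (int p) + (r (insert p S) - (s3 ''q'' 0 + s3 ''x'' (int p))))"
          have s6: "s6 ''z'' (int i) = z i + v' i" if "i \<in> {1..n}" for i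
            using S(5)[OF that] S(4) p(1) v0[of p]
            by (cases "i = p") (simp_all add: s6_def s4_def v'_def fr3 fp)
          have "I (Suc k) (store s6 ''q'' 0 (r (insert p S)))"
            unfolding I_def using gr s4 s6 S(2) finS p(1)
            by (intro exI[of _ "insert p S"] exI[of _ v']) (simp add: s6_def)
          then show ?thesis
            apply (intro wp_Seq wp_Assign wp_Rank)
            apply (simp add: p(2) flip: s4_def)
            apply (simp add: st)
            apply (simp add: s4_def p(2))
            apply (simp add: s6_def s4_def)
            done
        qed
        done
    qed
    subgoal premises prems for s1 s2
    proof -
      from prems(3) obtain S v where S: "greedy n f z S v" "card S = n"
        "\<And>i. i \<in> {1..n} \<Longrightarrow> s2 ''z'' (int i) = z i + v i"
        unfolding I_def by blast
      then have "S = {1..n}" using greedy_subset[OF S(1)] by (intro card_subset_eq) auto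
      then show ?thesis using S by blast
    qed
    done
qed

lemma wp_negativity:
  assumes n: "s ''n'' 0 = int n" and r: "r {} = 0" and t: "s ''t'' 0 = int T"
  defines "f \<equiv> \<lambda>A. r A - (\<Sum>i\<in>A. s ''x'' (int i))"
  shows "wp n r \<tau> negativity (negativity_time n T)
    (\<lambda>s'. \<exists>z. approach n f T z \<and> s' ''e'' 0 = (\<Sum>i\<in>{1..n}. max 0 (- z i))) s"
proof -
  define I where "I k s' \<longleftrightarrow> approach n f k (\<lambda>i. s' ''z'' (int i))" for k and s' :: state
  define E where "E k s' \<longleftrightarrow> s' ''e'' 0 = (\<Sum>i\<in>{1..k}. max 0 (- s' ''z'' (int i)))"
    for k :: nat and s' :: state
  show ?thesis
    unfolding negativity_def negativity_time_def
    apply (rule wp_Seq)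
    apply (rule wp_conseq[OF wp_zero[where s = s, OF n] order_refl], simp, simp)
    apply (rule wp_Seq)
    apply (rule wp_For[where I = I and N = T])
          apply (simp_all add: t)[4]
    subgoal unfolding I_def by (intro approach.zero) simp
    subgoal premises prems for s1 k s2
    proof -
      have "s2 ''n'' = s1 ''n''" "s2 ''x'' = s1 ''x''" using prems(5) by simp_all
      moreover have "s1 ''n'' = s ''n''" "s1 ''x'' = s ''x''" using prems(2) by simp_all
      ultimately have fr: "s2 ''n'' 0 = int n" "s2 ''x'' = s ''x''" using n by simp_all
      show ?thesis
        apply (rule wp_conseq[OF wp_add_greedy order_refl])
        apply (simp add: fr)
        apply (rule r)
        subgoal premises prems' for s3
        proof -
          from prems'(1) obtain v where v: "greedy n f (\<lambda>i. s2 ''z'' (int i)) {1..n} v"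
            "\<And>i. i \<in> {1..n} \<Longrightarrow> s3 ''z'' (int i) = s2 ''z'' (int i) + v i"
            unfolding f_def by (auto simp: fr)
          show ?thesis
            unfolding I_def using prems(4) v unfolding I_def by (rule approach.step)
        qed
        done
    qed
    apply (rule wp_Seq, rule wp_Assign)
    apply (rule wp_For[where I = E and N = n])
          apply simp_all[3]
    subgoal premises prems for s1 s2
      using prems(2)[of "''n''"] prems(4)[of "''n''"] n by simp
    subgoal by (simp add: E_def)
    subgoal premises prems for s1 s2 k s3
    proof -
      let ?s = "store s3 ''j'' 0 (int (Suc k))"
      have E: "E k s3" using prems(6) .
      have at: "{1..Suc k} = insert (Suc k) {1..k}" by auto
      show ?thesis
      proof (intro wp_Cond wp_Assign wp_Skip)
        show "E (Suc k) (store ?s ''e'' (aval (Num 0) ?s) (aval (Minus (V ''e'') (Cell ''z'' (V ''j''))) ?s))"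
          if "bval (Less (Cell ''z'' (V ''j'')) (Num 0)) ?s"
          using E that unfolding E_def at by simp
        show "E (Suc k) ?s" if "\<not> bval (Less (Cell ''z'' (V ''j'')) (Num 0)) ?s"
          using E that unfolding E_def at by simp
      qed
    qed
    subgoal premises prems for s1 s2 s3
    proof -
      have "s3 ''z'' = s2 ''z''" using prems(6) by simp
      then show ?thesis using prems(3,5) unfolding I_def E_def by auto
    qed
    done
qed

lemma wp_lay_brick:
  assumes r: "rank_function n r" and l: "l \<in> nonneg_vecs n" and \<tau>: "tie_rule n \<tau>"
    and M: "int M = lifted_rank r l {1..n}" and T: "(int n)\<^sup>2 * (int M + 1)\<^sup>2 < int T"
    and y: "y \<in> polymatroid n (lifted_rank r l)" "sum y {1..n} = int k" and k: "k < M"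
    and s: "s ''n'' 0 = int n" "s ''m'' 0 = int M" "s ''t'' 0 = int T" "s ''k'' 0 = int (Suc k)"
      "\<And>i. i \<in> {1..n} \<Longrightarrow> s ''l'' (int i) = l i"
      "\<And>i. i \<in> {1..n} \<Longrightarrow> s ''x'' (int i) = y i - l i"
  shows "wp n r \<tau> lay_brick (lay_brick_time n T) (\<lambda>s'. \<forall>i\<in>{1..n}.
    s' ''x'' (int i) = (y + unit_vec (\<tau> k (lowest_indices n (lifted_rank r l) y))) i - l i) s"
proof -
  let ?R = "lifted_rank r l"
  have R: "rank_function n ?R" by (rule rank_function_lifted_rank[OF r l])
  define G where "G i = (if y + unit_vec i \<in> polymatroid n ?R then y i else int M + 1)" for i
  define I where "I k s' \<longleftrightarrow> (\<forall>i\<in>{1..n}. s' ''x'' (int i) = y i - l i) \<and>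
      (\<forall>i\<in>{1..k}. s' ''g'' (int i) = G i) \<and> (\<forall>i\<in>{1..k}. s' ''b'' 0 \<le> G i) \<and>
      (s' ''b'' 0 = int M + 1 \<or> (\<exists>i\<in>{1..k}. s' ''b'' 0 = G i))" for k :: nat and s' :: state
  define J where "J k s' \<longleftrightarrow> (\<forall>i\<in>{1..k}. s' ''a'' (int i) = of_bool (\<not> s' ''b'' 0 < s' ''g'' (int i)))"
    for k :: nat and s' :: state
  \<comment> \<open>A free index exists and entries never exceed \<open>M\<close>, so the key
    \<open>M + 1\<close> of blocked indices is never the minimum; the least key is thus the height
    of a lowest index, and it is attained exactly on the lowest indices.\<close>
  have lowest: "{i \<in> {1..n}. G i \<le> b} = lowest_indices n ?R y"
    if b: "\<And>i. i \<in> {1..n} \<Longrightarrow> b \<le> G i" "b = int M + 1 \<or> (\<exists>i\<in>{1..n}. b = G i)" for b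
  proof -
    have "lowest_indices n ?R y \<noteq> {}"
      using lowest_indices_nonempty[OF R y(1)] y(2) k M by simp
    then obtain p where p: "p \<in> lowest_indices n ?R y" by blast
    then have p': "p \<in> {1..n}" "G p = y p" by (auto simp: lowest_indices_iff G_def)
    have yM: "y i \<le> int M" if i: "i \<in> {1..n}" for i
    proof -
      have "sum y {i} \<le> ?R {i}" using y(1) i unfolding polymatroid_def by blast
      also have "\<dots> \<le> ?R {1..n}" using i by (intro rank_functionD(3)[OF R]) auto
      finally show ?thesis using M by simp
    qed
    have Gp: "G p \<le> G i" if "i \<in> {1..n}" for i
      using p p'(2) yM[OF p'(1)] that by (auto simp: lowest_indices_iff G_def)
    have "b = y p" using b Gp p' yM[OF p'(1)] by force
    show ?thesis
    proof (intro set_eqI iffI)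
      fix i assume "i \<in> {i \<in> {1..n}. G i \<le> b}"
      then have i: "i \<in> {1..n}" "G i \<le> y p" using \<open>b = y p\<close> by auto
      then have feasible: "y + unit_vec i \<in> polymatroid n ?R" using yM[OF p'(1)] by (auto simp: G_def split: if_splits)
      then have "y i \<le> y p" using i(2) by (simp add: G_def)
      then show "i \<in> lowest_indices n ?R y"
        using p i(1) feasible unfolding lowest_indices_iff by (blast intro: order_trans)
    next
      fix i assume i: "i \<in> lowest_indices n ?R y"
      then have "y i \<le> y p" using p unfolding lowest_indices_iff by blast
      then show "i \<in> {i \<in> {1..n}. G i \<le> b}"
        using i \<open>b = y p\<close> unfolding lowest_indices_iff G_def by simp
    qed
  qed
  show ?thesis
    unfolding lay_brick_def lay_brick_time_def
    apply (rule wp_Seq, rule wp_Assign)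
    apply (rule wp_Seq)
    apply (rule wp_For[where I = I and N = n])
          apply (simp_all add: s)[4]
    subgoal by (simp add: I_def s)
    subgoal premises prems for j s1
    proof -
      let ?i = "Suc j"
      define s2 where "s2 = store s1 ''i'' 0 (int ?i)"
      have i: "?i \<in> {1..n}" using prems(1) by simp
      have fr1: "s1 ''n'' 0 = int n" "s1 ''m'' 0 = int M" "s1 ''t'' 0 = int T" "s1 ''l'' = s ''l''"
        using prems(3)[of "''n''"] prems(3)[of "''m''"] prems(3)[of "''t''"] prems(3)[of "''l''"] s by simp_all
      have I: "I j s1" using prems(2) .
      \<comment> \<open>The brick on \<open>?i\<close> is tentative: it is present only while the
        test runs, which makes array \<open>x\<close> the vector \<open>w\<close> of
        \<open>extension_test\<close>.\<close>
      define s3 where "s3 = store s2 ''x'' (int ?i) (s2 ''x'' (int ?i) + 1)"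
      let ?A = "Cond (Less (V ''e'') (V ''t''))
              (Assign ''g'' (V ''i'') (Plus (Cell ''x'' (V ''i'')) (Cell ''l'' (V ''i''))))
              (Assign ''g'' (V ''i'') (Plus (V ''m'') (Num 1)))"
      let ?B = "Cond (Less (Cell ''g'' (V ''i'')) (V ''b'')) (Set ''b'' (Cell ''g'' (V ''i''))) Skip"
      have eq_Suc: "int h = 1 + int j \<longleftrightarrow> h = ?i" for h by linarith
      have x3: "s3 ''x'' (int h) = y h - l h + of_bool (h = ?i)" if "h \<in> {1..n}" for h
      proof -
        have "s1 ''x'' (int h) = y h - l h" using that I unfolding I_def by blast
        then show ?thesis by (cases "h = ?i") (simp_all add: s3_def s2_def eq_Suc)
      qed
      have "wp n r \<tau> negativity (negativity_time n T) (\<lambda>s4. wp n r \<tau>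
          (Seq (Assign ''x'' (V ''i'') (Minus (Cell ''x'' (V ''i'')) (Num 1))) (Seq ?A ?B))
          (1 + (2 + 2)) (I (Suc j)) s4) s3"
        apply (rule wp_conseq[OF wp_negativity[where T = T] order_refl])
           apply (simp add: s3_def s2_def fr1)
          apply (rule rank_functionD(1)[OF r])
         apply (simp add: s3_def s2_def fr1)
        subgoal premises prems' for s4
        proof -
          from prems'(1) obtain z where z: "approach n (\<lambda>A. r A - (\<Sum>i\<in>A. s3 ''x'' (int i))) T z"
            "s4 ''e'' 0 = (\<Sum>i\<in>{1..n}. max 0 (- z i))" by blast
          have fr4: "s4 ''x'' = s3 ''x''" "s4 ''i'' 0 = int ?i" "s4 ''t'' 0 = int T" "s4 ''m'' 0 = int M"
            "s4 ''l'' = s ''l''" "s4 ''g'' = s1 ''g''" "s4 ''b'' = s1 ''b''"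
            using prems'(2)[of "''x''"] prems'(2)[of "''i''"] prems'(2)[of "''t''"] prems'(2)[of "''m''"]
              prems'(2)[of "''l''"] prems'(2)[of "''g''"] prems'(2)[of "''b''"]
            by (simp_all add: s3_def s2_def fr1)
          have feas: "s4 ''e'' 0 < int T \<longleftrightarrow> y + unit_vec ?i \<in> polymatroid n ?R"
            unfolding z(2) by (rule extension_test[OF r l y(1) i M x3 z(1) T])
          define s5 where "s5 = store s4 ''x'' (int ?i) (s4 ''x'' (int ?i) - 1)"
          have x5: "s5 ''x'' (int h) = y h - l h" if "h \<in> {1..n}" for h
            using x3[OF that] by (cases "h = ?i") (simp_all add: s5_def fr4 eq_Suc)
          have fr5: "s5 ''i'' 0 = int ?i" "s5 ''t'' 0 = int T" "s5 ''m'' 0 = int M" "s5 ''e'' = s4 ''e''"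
            "s5 ''l'' = s ''l''" "s5 ''g'' = s1 ''g''" "s5 ''b'' = s1 ''b''"
            by (simp_all add: s5_def fr4)
          define s6 where "s6 = store s5 ''g'' (int ?i) (G ?i)"
          have at: "{1..Suc j} = insert ?i {1..j}" by auto
          have fr6: "s6 ''i'' 0 = int ?i" "s6 ''b'' = s1 ''b''" "s6 ''g'' (int ?i) = G ?i"
            by (simp_all add: s6_def fr5)
          have 6: "\<forall>i\<in>{1..n}. s6 ''x'' (int i) = y i - l i" "\<forall>i\<in>{1..Suc j}. s6 ''g'' (int i) = G i"
            using x5 I by (auto simp: s6_def at fr5 I_def eq_Suc)
          have B: "wp n r \<tau> ?B 2 (I (Suc j)) s6"
          proof (intro wp_Cond wp_Assign wp_Skip)
            have *: "\<forall>i\<in>{1..j}. s1 ''b'' 0 \<le> G i" 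
                "s1 ''b'' 0 = int M + 1 \<or> (\<exists>i\<in>{1..j}. s1 ''b'' 0 = G i)"
              using I by (auto simp: I_def)
            show "I (Suc j) (store s6 ''b'' (aval (Num 0) s6) (aval (Cell ''g'' (V ''i'')) s6))"
              if "bval (Less (Cell ''g'' (V ''i'')) (V ''b'')) s6"
            proof -
              have "G ?i < s1 ''b'' 0" using that by (simp add: fr6 del: of_nat_Suc)
              then have "\<forall>i\<in>{1..j}. G ?i \<le> G i" using *(1) by fastforce
              then show ?thesis
                using 6 unfolding I_def at by (simp add: fr6 del: of_nat_Suc)
            qed
            show "I (Suc j) s6" if "\<not> bval (Less (Cell ''g'' (V ''i'')) (V ''b'')) s6"
            proof -
              have "s1 ''b'' 0 \<le> G ?i" using that by (simp add: fr6 del: of_nat_Suc)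
              then show ?thesis
                using 6 * unfolding I_def at by (simp add: fr6) blast
            qed
          qed
          have "wp n r \<tau> ?A 2 (wp n r \<tau> ?B 2 (I (Suc j))) s5"
          proof (rule wp_Cond; rule wp_Assign)
            show "wp n r \<tau> ?B 2 (I (Suc j)) (store s5 ''g'' (aval (V ''i'') s5)
                (aval (Plus (Cell ''x'' (V ''i'')) (Cell ''l'' (V ''i''))) s5))"
              if "bval (Less (V ''e'') (V ''t'')) s5"
            proof -
              have "aval (Plus (Cell ''x'' (V ''i'')) (Cell ''l'' (V ''i''))) s5 = G ?i"
                using that feas x5[OF i] s(5)[OF i] by (simp add: fr5 G_def del: of_nat_Suc)
              then show ?thesis using B by (simp add: s6_def fr5 del: of_nat_Suc)
            qed
            show "wp n r \<tau> ?B 2 (I (Suc j)) (store s5 ''g'' (aval (V ''i'') s5)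
                (aval (Plus (V ''m'') (Num 1)) s5))"
              if "\<not> bval (Less (V ''e'') (V ''t'')) s5"
            proof -
              have "aval (Plus (V ''m'') (Num 1)) s5 = G ?i"
                using that feas by (simp add: fr5 G_def)
              then show ?thesis using B by (simp add: s6_def fr5 del: of_nat_Suc)
            qed
          qed
          then show ?thesis
            by (intro wp_Seq wp_Assign) (simp add: s5_def fr4 del: of_nat_Suc)
        qed
        done
      then show ?thesis
        by (intro wp_Seq wp_Assign) (simp add: s3_def s2_def del: of_nat_Suc)
    qed
    apply (rule wp_Seq)
    apply (rule wp_For[where I = J and N = n])
          apply simp_all[3]
    subgoal premises prems for s1 using prems(2)[of "''n''"] s(1) by simp
    subgoal by (simp add: J_def)
    subgoal premises prems for s1 j s2
    proof -
      let ?s = "store s2 ''i'' 0 (int (Suc j))"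
      have at: "{1..Suc j} = insert (Suc j) {1..j}" by auto
      show ?thesis
      proof (intro wp_Cond wp_Assign)
        show "J (Suc j) (store ?s ''a'' (aval (V ''i'') ?s) (aval (Num 0) ?s))"
          if "bval (Less (V ''b'') (Cell ''g'' (V ''i''))) ?s"
          using prems(4) that unfolding J_def at by simp
        show "J (Suc j) (store ?s ''a'' (aval (V ''i'') ?s) (aval (Num 1) ?s))"
          if "\<not> bval (Less (V ''b'') (Cell ''g'' (V ''i''))) ?s"
          using prems(4) that unfolding J_def at by simp
      qed
    qed
    subgoal premises prems for s1 s2
    proof -
      have I: "I n s1" and J: "J n s2" using prems(1,3) by simp_all
      have fr: "s2 ''k'' 0 = int (Suc k)" "s2 ''b'' = s1 ''b''" "s2 ''g'' = s1 ''g''" "s2 ''x'' = s1 ''x''"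
        using prems(2)[of "''k''"] prems(4)[of "''k''"] prems(4)[of "''b''"]
          prems(4)[of "''g''"] prems(4)[of "''x''"] s(4) by simp_all
      \<comment> \<open>Inside the body the loop counter is \<open>Suc k\<close>; subtracting one
        gives the iteration number \<open>k\<close> that the tie-breaking rule expects.\<close>
      define p where "p = \<tau> k (lowest_indices n ?R y)"
      have "stored_set n (store s2 ''o'' 0 c) ''a'' = {i \<in> {1..n}. G i \<le> s1 ''b'' 0}" for c
        using J I unfolding stored_set_def J_def I_def fr by (auto simp: not_less)
      also have "\<dots> = lowest_indices n ?R y" using I by (intro lowest) (auto simp: I_def)
      finally have tie: "stored_set n (store s2 ''o'' 0 c) ''a'' = lowest_indices n ?R y" for c .
      show ?thesis
        apply (intro wp_Seq wp_Assign wp_Tie)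
        using I unfolding I_def
        apply (simp add: fr tie unit_vec_def flip: p_def)
        done
    qed
    done
qed

lemma wp_brick_laying:
  assumes r: "rank_function n r" and l: "l \<in> nonneg_vecs n" and \<tau>: "tie_rule n \<tau>"
    and M: "int M = lifted_rank r l {1..n}"
  shows "wp n r \<tau> brick_laying (brick_laying_time n M)
    (\<lambda>s'. output_vec n s' = bricks n (lifted_rank r l) \<tau> M - l) (input_state n l)"
proof -
  let ?R = "lifted_rank r l" and ?s = "input_state n l"
  let ?U = "n * (M + 1)"
  have R: "rank_function n ?R" by (rule rank_function_lifted_rank[OF r l])
  have inp: "?s ''n'' 0 = int n" "?s ''m'' 0 = 0" "?s ''u'' 0 = 0"
    "\<And>i. i \<in> {1..n} \<Longrightarrow> ?s ''l'' (int i) = l i"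
    by (simp_all add: input_state_def)
  define I where "I k s' \<longleftrightarrow> (\<forall>i\<in>{1..k}. s' ''s'' (int i) = 1 \<and> s' ''x'' (int i) = - l i) \<and>
      s' ''m'' 0 = sum l {1..k}" for k :: nat and s' :: state
  define J where "J k s' \<longleftrightarrow> s' ''u'' 0 = int (k * (M + 1))" for k :: nat and s' :: state
  define K where "K k s' \<longleftrightarrow> s' ''t'' 0 = int (1 + k * ?U)" for k :: nat and s' :: state
  define L where "L k s' \<longleftrightarrow> (\<forall>i\<in>{1..n}. s' ''x'' (int i) = bricks n ?R \<tau> k i - l i)"
    for k :: nat and s' :: state
  have at: "{1..Suc k} = insert (Suc k) {1..k}" for k by auto
  \<comment> \<open>The left side is \<open>?U * ?U\<close>, so the number of rounds exceeds the
    threshold of \<open>extension_test\<close> by exactly one.\<close>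
  have T: "(int n)\<^sup>2 * (int M + 1)\<^sup>2 < int (1 + ?U * ?U)"
    by (simp add: power2_eq_square algebra_simps)
  note inv = bricks_invariant[OF R \<tau>]
  show ?thesis
    unfolding brick_laying_def brick_laying_time_def Let_def
    apply (rule wp_Seq)
    apply (rule wp_For[where I = I and N = n])
          apply (simp_all add: inp)[4]
    subgoal by (simp add: I_def inp)
    subgoal premises prems for k s1
    proof -
      have "s1 ''l'' = ?s ''l''" using prems(3) by simp
      then have "s1 ''l'' (int (Suc k)) = l (Suc k)" using inp(4)[of "Suc k"] prems(1) by simp
      then show ?thesis
        using prems(2) unfolding I_def at
        by (intro wp_Seq wp_Assign) simp
    qed
    apply (rule wp_Seq, rule wp_Rank)
    apply (rule wp_Seq, rule wp_Assign)
    apply (rule wp_Seq, rule wp_Assign)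
    apply (rule wp_Seq)
    apply (rule wp_For[where I = J and N = n])
          apply simp_all[3]
    subgoal premises prems for s1 using prems(2)[of "''n''"] inp by simp
    subgoal premises prems for s1 using prems(2)[of "''u''"] inp by (simp add: J_def)
    subgoal premises prems for s1 k s2
    proof -
      have "stored_set n s1 ''s'' = {1..n}" "s1 ''m'' 0 = sum l {1..n}"
        using prems(1) unfolding I_def stored_set_def by auto
      then have "s2 ''b'' 0 = int M + 1"
        using prems(5)[of "''b''"] M by (simp add: lifted_rank_def)
      then show ?thesis
        using prems(4) unfolding J_def by (intro wp_Assign) (simp add: algebra_simps)
    qed
    apply (rule wp_Seq, rule wp_Assign)
    apply (rule wp_Seq)
    apply (rule wp_For[where I = K and N = ?U])
          apply simp_all[3]
    subgoal premises prems for s1 s2 using prems(3) by (simp add: J_def)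
    subgoal by (simp add: K_def)
    subgoal premises prems for s1 s2 k s3
    proof -
      have "s3 ''u'' 0 = int ?U" using prems(3) prems(7)[of "''u''"] by (simp add: J_def)
      then show ?thesis
        using prems(6) unfolding K_def by (intro wp_Assign) (simp add: algebra_simps)
    qed
    subgoal premises prems for s1 s2 s3
    proof -
      have fr: "s3 ''n'' 0 = int n" "s3 ''l'' = ?s ''l''" "s3 ''x'' = s1 ''x''"
        using prems(2)[of "''n''"] prems(2)[of "''l''"] prems(4)[of "''n''"] prems(4)[of "''l''"]
          prems(4)[of "''x''"] prems(6)[of "''n''"] prems(6)[of "''l''"] prems(6)[of "''x''"] inp
        by simp_all
      have "stored_set n s1 ''s'' = {1..n}" "s1 ''m'' 0 = sum l {1..n}"
        using prems(1) unfolding I_def stored_set_def by auto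
      then have m: "s3 ''m'' 0 = int M"
        using prems(4)[of "''m''"] prems(6)[of "''m''"] M by (simp add: lifted_rank_def)
      have t: "s3 ''t'' 0 = int (1 + ?U * ?U)" using prems(5) by (simp add: K_def)
      show ?thesis
        apply (rule wp_For[where I = L and N = M])
              apply simp_all[3]
           apply (rule m)
        subgoal using prems(1) by (simp add: L_def I_def fr)
        subgoal premises prems' for k s4
        proof -
          let ?s5 = "store s4 ''k'' 0 (int (Suc k))"
          have fr4: "s4 ''n'' = s3 ''n''" "s4 ''l'' = s3 ''l''" "s4 ''m'' = s3 ''m''" "s4 ''t'' = s3 ''t''"
            using prems'(3) by simp_all
          have y: "bricks n ?R \<tau> k \<in> polymatroid n ?R" "sum (bricks n ?R \<tau> k) {1..n} = int k"
            using inv[of k] prems'(1) M by auto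
          have "wp n r \<tau> lay_brick (lay_brick_time n (1 + ?U * ?U)) (\<lambda>s'. \<forall>i\<in>{1..n}. s' ''x'' (int i) =
              (bricks n ?R \<tau> k + unit_vec (\<tau> k (lowest_indices n ?R (bricks n ?R \<tau> k)))) i - l i) ?s5"
          proof (rule wp_lay_brick[OF r l \<tau> M T y prems'(1)])
            show "?s5 ''n'' 0 = int n" "?s5 ''m'' 0 = int M" "?s5 ''k'' 0 = int (Suc k)"
              using fr m by (simp_all add: fr4)
            show "?s5 ''t'' 0 = int (1 + ?U * ?U)" using t by (simp add: fr4)
            show "?s5 ''l'' (int i) = l i" if "i \<in> {1..n}" for i
              using inp(4)[OF that] by (simp add: fr4 fr)
            show "?s5 ''x'' (int i) = bricks n ?R \<tau> k i - l i" if "i \<in> {1..n}" for i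
              using prems'(2) that by (simp add: L_def)
          qed
          then show ?thesis unfolding L_def by simp
        qed
        subgoal premises prems' for s4
        proof
          fix i
          \<comment> \<open>Outside \<open>{1..n}\<close> both \<open>bricks\<close> and
            \<open>l\<close> vanish, which agrees with the default value of
            \<open>output_vec\<close>.\<close>
          have "bricks n ?R \<tau> M \<in> nonneg_vecs n" using inv[of M] M by (auto simp: polymatroid_def)
          then show "output_vec n s4 i = (bricks n ?R \<tau> M - l) i"
            using prems'(1) l unfolding L_def by (auto simp: output_vec_def nonneg_vecs_def)
        qed
        done
    qed
    done
qed

section \<open>The polynomial bound\<close>

lemma brick_laying_time_mono:
  fixes n m N :: nat
  assumes "n \<le> N" "m \<le> N"
  shows "brick_laying_time n m \<le> brick_laying_time N N"
  unfolding brick_laying_time_def lay_brick_time_def negativity_time_def add_greedy_time_def Let_def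
  by (intro add_mono mult_mono order_refl assms zero_le)

text \<open>Evaluation of polynomials is a semiring homomorphism, so it commutes with the arithmetic
  of the bound.\<close>

lemma poly_brick_laying_time:
  "poly (brick_laying_time p q) x = brick_laying_time (poly p x) (poly q x)"
  unfolding brick_laying_time_def lay_brick_time_def negativity_time_def add_greedy_time_def Let_def
  by simp

theorem proposition1:
  shows "\<exists>(c :: com) (p :: nat poly).
    \<forall>(n :: nat) (r :: nat set \<Rightarrow> int) (l :: nat \<Rightarrow> int) (\<tau> :: nat \<Rightarrow> nat set \<Rightarrow> nat).
      rank_function n r \<and> l \<in> nonneg_vecs n \<and> tie_rule n \<tau> \<longrightarrow>
      (\<exists>x. brick_laying_returns n r l \<tau> x \<and>
           x \<in> bases n r \<and>
           (\<forall>y \<in> bases n r. majorized_by n (x + l) (y + l)) \<and>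
           (\<exists>t s. exec n r \<tau> c (input_state n l) t s \<and>
                  output_vec n s = x \<and>
                  t \<le> poly p (input_size n r l)))"
proof (intro exI[of _ brick_laying] exI[of _ "brick_laying_time [:0, 1:] [:0, 1:]"] allI impI)
  fix n r l \<tau> assume A: "rank_function n r \<and> l \<in> nonneg_vecs n \<and> tie_rule n \<tau>"
  then have r: "rank_function n r" and l: "l \<in> nonneg_vecs n" and \<tau>: "tie_rule n \<tau>" by auto
  let ?R = "lifted_rank r l" and ?N = "input_size n r l"
  define M where "M = nat (?R {1..n})"
  let ?x = "bricks n ?R \<tau> M - l"
  have "0 \<le> ?R {1..n}" by (rule rank_functionD(2)[OF rank_function_lifted_rank[OF r l]]) simp
  then have "int M = ?R {1..n}" by (simp add: M_def)
  from wp_brick_laying[OF r l \<tau> this] obtain t s where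
    run: "exec n r \<tau> brick_laying (input_state n l) t s" "t \<le> brick_laying_time n M" "output_vec n s = ?x"
    by (auto simp: wp_def)
  \<comment> \<open>Both parameters of the bound are at most the input size, so by monotonicity each
    may be replaced by it; the indeterminate \<open>[:0, 1:]\<close> evaluates to this size.\<close>
  have "n \<le> ?N" "M \<le> ?N" by (auto simp: input_size_def M_def lifted_rank_def)
  then have "t \<le> poly (brick_laying_time [:0, 1:] [:0, 1:]) ?N"
    using run(2) brick_laying_time_mono by (fastforce simp: poly_brick_laying_time)
  then show "\<exists>x. brick_laying_returns n r l \<tau> x \<and> x \<in> bases n r \<and>
      (\<forall>y \<in> bases n r. majorized_by n (x + l) (y + l)) \<and>
      (\<exists>t s. exec n r \<tau> brick_laying (input_state n l) t s \<and> output_vec n s = x \<and>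
        t \<le> poly (brick_laying_time [:0, 1:] [:0, 1:]) ?N)"
    using brick_laying_correct[OF r l \<tau>, folded M_def] run by blast
qed

end
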